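(* In the setting described in the context (adaptive sampling densities $\psi_i$, samples $\theta_i$, integrand $F$, compact set $\mathcal{X}\subset\mathbb{R}^m$), suppose that: (1) $\Theta\subset\Theta_i$ a.s. for every $i\in\mathbb{N}$; (2) for every $x\in\mathcal{X}$, $F(x,\cdot)$ is integrable, that is, $f(x)=\int_\Theta F(x,\theta)\,d\theta<\infty$; (3) for every given $x\in\mathcal{X}$, $\sup_{i\in\mathbb{N}}\sup_{\theta_i\in\Theta_i}\left|\frac{F(x,\theta_i)}{\psi_i(\theta_i)}\right|<\infty$ a.s.; (4) for every $i\in\mathbb{N}$ and every $x\in\mathcal{X}$, $\frac{F^2(x,\cdot)}{\psi_i(\cdot)}$ is integrable on $\Theta_i$; (5) $f$ is continuous on the compact set $\mathcal{X}$. Let $\varpi$ be a modulus of continuity, and let $H_n(x)=f_n(x)-f(x)=\frac1n\sum_{i=1}^n\frac{F(x,\theta_i)}{\psi_i(\theta_i)}-f(x)$. For an adaptive multiple coefficient $(\alpha_i)$, put $A_i(\theta_i)=\frac{\alpha_i(\theta_i)}{\psi_i(\theta_i)}$ and $A_n=\frac1n\sum_{i=1}^nA_i(\theta_i)$. Then the following hold. (i) If $F(x,\theta)$ is strictly AMMC from below on $\mathcal{X}$ in the sense of $\varpi$ with adaptive multiple coefficient $\alpha_i$, and if for any $\varepsilon>0$ there exist constants $M(\varepsilon)>0$ and $\tau(\varepsilon)>0$ such that $\mathrm{Prob}\big(A_n\ge\varepsilon M(\varepsilon)\big)\le e^{-n\tau(\varepsilon)}$ for all $n$, then for every $\varepsilon>0$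 there exist positive constants $\lambda(\varepsilon)$ and $\gamma(\varepsilon)$ such that for all $n$ $$\mathrm{Prob}\left\{\inf_{x\in\mathcal{X}}H_n(x)\le-\varepsilon\right\}\le\lambda(\varepsilon)e^{-n\gamma(\varepsilon)}.$$ (ii) If $F(x,\theta)$ is strictly AMMC from above on $\mathcal{X}$ in the sense of $\varpi$ with adaptive multiple coefficient $\alpha_i$, and if for any $\varepsilon>0$ there exist constants $M(\varepsilon)>0$ and $\tau(\varepsilon)>0$ such that $\mathrm{Prob}\big(A_n\ge\varepsilon M(\varepsilon)\big)\le e^{-n\tau(\varepsilon)}$ for all $n$, then for every $\varepsilon>0$ there exist positive constants $\lambda(\varepsilon)$ and $\gamma(\varepsilon)$ such that for all $n$ $$\mathrm{Prob}\left\{\sup_{x\in\mathcal{X}}H_n(x)\ge\varepsilon\right\}\le\lambda(\varepsilon)e^{-n\gamma(\varepsilon)}.$$ (iii) If $F(x,\theta)$ is strictly AMMC on $\mathcal{X}$ in the sense of $\varpi$ with adaptive multiple coefficient $\alpha_i$, and if for any $\varepsilon>0$ there exist constants $M(\varepsilon)>0$ and $\tau(\varepsilon)>0$ such that $\mathrm{Prob}\big(A_n\ge\varepsilon M(\varepsilon)\big)\le e^{-n\tau(\varepsilon)}$ for all $n$, then for every $\varepsilon>0$ there exist positive constants $\lambda(\varepsilon)$ and $\gamma(\varepsilon)$ such that for all $n$ $$\mathrm{Prob}\left\{\sup_{x\in\mathcal{X}}|H_n(x)|\ge\varepsilon\right\}\le\lambda(\varepsilon)e^{-n\gamma(\vare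psilon)}.$$
   Context: Setting. $(\Omega,\mathcal{F},P)$ is a probability space; $\Theta\subset\mathbb{R}^r$; $\mathcal{X}\subset\mathbb{R}^m$ is compact. $\{\theta_i\}_{i\ge1}$ is a sequence of $\mathbb{R}^r$-valued random vectors with natural filtration $\mathcal{G}_i=\sigma(\theta_1,\dots,\theta_i)$, $\mathcal{G}_0=\{\emptyset,\Omega\}$. Given $\mathcal{G}_{i-1}$, the conditional distribution of $\theta_i$ has a density $\psi_i$ (which may depend on $\theta_1,\dots,\theta_{i-1}$) whose support is $\Theta_i\subset\mathbb{R}^r$. $F:\mathcal{X}\times\mathbb{R}^r\to\mathbb{R}$ is a function whose support is contained in $\mathcal{X}\times\Theta$; in particular $F(\cdot,\theta)=0$ for $\theta\in\Theta_i\setminus\Theta$. Moreover $f(x)=\int_\Theta F(x,\theta)\,d\theta$ and $f_n(x)=\frac1n\sum_{i=1}^n\frac{F(x,\theta_i)}{\psi_i(\theta_i)}$ (sample average approximation with adaptive multiple importance sampling). A modulus of continuity is a strictly increasing continuous function $\varpi$ on $\mathbb{R}_+$ with $\lim_{x\to0^+}\varpi(x)=0$ and $\limsup_{x\to0^+}\frac{x}{\varpi(x)}<+\infty$. Adaptive multiple modulus calmness (AMMC). A family of integrable functions $\alpha_i:\Theta_i\to\mathbb{R}_+$ ($i\in\mathbb{N}$), adapted to the filtration $\mathcal{G}_{i-1}$ (i.e. $\alpha_i$ may depend on $\theta_1,\dots,\theta_{i-1}$), is called an adaptive multiple coefficient. $F$ is strictly AMMC from below at $x_0\in\mathcal{X}$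 in the sense of $\varpi$ with adaptive multiple coefficient $\alpha_i$ if there is $\delta(x_0)>0$ such that, for every $i\in\mathbb{N}$, $$F(x,\theta_i)-F(x',\theta_i)\ge-\alpha_i(\theta_i)\varpi(\|x-x'\|)\quad\forall\theta_i\in\Theta_i,$$ for all $x,x'\in\mathcal{X}$ with $0<\|x-x'\|<\delta(x_0)$. It is strictly AMMC from above at $x_0$ if $-F$ is strictly AMMC from below at $x_0$ with the same coefficient, i.e. $F(x,\theta_i)-F(x',\theta_i)\le\alpha_i(\theta_i)\varpi(\|x-x'\|)$ for the same $x,x',\theta_i,i$. It is strictly AMMC at $x_0$ if it is both, with the same coefficient, i.e. $|F(x,\theta_i)-F(x',\theta_i)|\le\alpha_i(\theta_i)\varpi(\|x-x'\|)$ for the same $x,x',\theta_i,i$. It has one of these properties on $\mathcal{X}$ if it has it at every point of $\mathcal{X}$ (with the same $\varpi$ and $\alpha_i$).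
   Formalization: Hypothesis (3) is taken with a non-random bound: for each x there is a constant C(x) with sup_i sup over Θ_i of |F/ψ_i| ≤ C(x) a.s.; with only an a.s. finite random supremum the claim fails, e.g. if ψ_i gives [0,1] mass 1/K(θ_1) with K heavy-tailed. *)

theory Defs
  imports "HOL-Probability.Probability"
begin

text \<open>Sequences are indexed by \<open>i \<ge> 1\<close>; the values at index \<open>0\<close> are never used.\<close>

text \<open>\<open>natural_filtration M \<theta> i\<close> is \<open>\<sigma>(\<theta>\<^sub>1, \<dots>, \<theta>\<^sub>i)\<close>, and the trivial algebra for
  \<open>i = 0\<close>. Only its space and its measurable sets matter.\<close>

definition natural_filtration ::
    "'w measure \<Rightarrow> (nat \<Rightarrow> 'w \<Rightarrow> 'a::topological_space) \<Rightarrow> nat \<Rightarrow> 'w measure" where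
  "natural_filtration M \<theta> i =
     sigma (space M) (\<Union>k\<in>{1..i}. {\<theta> k -` B \<inter> space M | B. B \<in> sets borel})"

text \<open>\<open>p \<omega>\<close> is a density, with respect to Lebesgue measure, of the conditional distribution of
  \<open>Y\<close> given the sub-\<open>\<sigma>\<close>-algebra \<open>G\<close>. Its dependence on the conditioning variables is expressed
  by joint measurability with respect to \<open>G\<close> and the Borel sets. That \<open>p \<omega>\<close> is almost surely
  integrable with total mass 1 is the case \<open>B = UNIV\<close> (the Bochner integral of a
  non-integrable function is 0).\<close>

definition conditional_density ::
    "'w measure \<Rightarrow> 'w measure \<Rightarrow> ('w \<Rightarrow> 'a::euclidean_space) \<Rightarrow> ('w \<Rightarrow> 'a \<Rightarrow> real) \<Rightarrow> bool" where
  "conditional_density M G Y p \<longleftrightarrow>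
     (\<lambda>(\<omega>, t). p \<omega> t) \<in> borel_measurable (G \<Otimes>\<^sub>M borel) \<and>
     (\<forall>\<omega>\<in>space M. \<forall>t. 0 \<le> p \<omega> t) \<and>
     (\<forall>B\<in>sets borel. AE \<omega> in M.
        real_cond_exp M G (\<lambda>\<omega>. indicator B (Y \<omega>)) \<omega> = (LINT t:B|lborel. p \<omega> t))"

text \<open>The random set \<open>\<Theta>\<^sub>i\<close>. Supports are non-vanishing sets, without closure: the quotients by
  \<open>\<psi>\<^sub>i\<close> are taken on all of \<open>\<Theta>\<^sub>i\<close>.\<close>

definition sample_support ::
    "(nat \<Rightarrow> 'w \<Rightarrow> 'a \<Rightarrow> real) \<Rightarrow> nat \<Rightarrow> 'w \<Rightarrow> 'a set" where
  "sample_support \<psi> i \<omega> = support_on UNIV (\<psi> i \<omega>)"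

text \<open>The bound is a constant, not a random variable: the supremum is almost surely at most some
  real number that does not depend on \<open>\<omega>\<close>. With an almost surely finite random bound the
  exponential estimates fail. Take \<open>F x = indicator {0..1}\<close>, \<open>\<alpha>\<^sub>i = 0\<close>, and let all \<open>\<psi>\<^sub>i\<close> with
  \<open>i \<ge> 2\<close> put mass \<open>1 / K\<close> uniformly on \<open>{0..1}\<close> and the rest on \<open>{1<..2}\<close>, where
  \<open>K = K(\<theta>\<^sub>1) \<ge> 1\<close> has a polynomial tail: when \<open>K > n\<close>, with probability bounded away from 0
  none of the samples \<open>\<theta>\<^sub>2, \<dots>, \<theta>\<^sub>n\<close> lies in \<open>{0..1}\<close>.\<close>

definition bounded_ratio ::
    "'w measure \<Rightarrow> (nat \<Rightarrow> 'w \<Rightarrow> 'a \<Rightarrow> real) \<Rightarrow> ('a \<Rightarrow> real) \<Rightarrow> bool" where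
  "bounded_ratio M \<psi> g \<longleftrightarrow>
     (\<exists>C::real. AE \<omega> in M.
        (SUP i\<in>{1..}. SUP t\<in>sample_support \<psi> i \<omega>. ereal \<bar>g t / \<psi> i \<omega> t\<bar>) \<le> ereal C)"

definition modulus_of_continuity :: "(real \<Rightarrow> real) \<Rightarrow> bool" where
  "modulus_of_continuity w \<longleftrightarrow>
     strict_mono_on {0..} w \<and> continuous_on {0..} w \<and>
     (w \<longlongrightarrow> 0) (at_right 0) \<and>
     Limsup (at_right 0) (\<lambda>x. ereal (x / w x)) < \<infinity>"

text \<open>\<open>\<alpha> i \<omega>\<close> is only meaningful on \<open>\<Theta>\<^sub>i\<close>; joint measurability of the total function means no
  loss of generality, since it may be extended by 0.\<close>

definition adaptive_multiple_coefficient ::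
    "'w measure \<Rightarrow> (nat \<Rightarrow> 'w \<Rightarrow> 'a::euclidean_space) \<Rightarrow> (nat \<Rightarrow> 'w \<Rightarrow> 'a \<Rightarrow> real) \<Rightarrow>
     (nat \<Rightarrow> 'w \<Rightarrow> 'a \<Rightarrow> real) \<Rightarrow> bool" where
  "adaptive_multiple_coefficient M \<theta> \<psi> \<alpha> \<longleftrightarrow>
     (\<forall>i\<ge>1.
        (\<lambda>(\<omega>, t). \<alpha> i \<omega> t) \<in> borel_measurable (natural_filtration M \<theta> (i - 1) \<Otimes>\<^sub>M borel) \<and>
        (AE \<omega> in M. (\<forall>t\<in>sample_support \<psi> i \<omega>. 0 \<le> \<alpha> i \<omega> t) \<and>
           set_integrable lborel (sample_support \<psi> i \<omega>) (\<alpha> i \<omega>)))"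

text \<open>The pairs \<open>x, x'\<close> range over all of \<open>X\<close>; the point \<open>x0\<close> enters only through the choice
  of \<open>\<delta>\<close>.\<close>

definition strictly_AMMC_below_at ::
    "'w measure \<Rightarrow> (nat \<Rightarrow> 'w \<Rightarrow> 'a \<Rightarrow> real) \<Rightarrow> 'b::real_normed_vector set \<Rightarrow>
     ('b \<Rightarrow> 'a \<Rightarrow> real) \<Rightarrow> (real \<Rightarrow> real) \<Rightarrow> (nat \<Rightarrow> 'w \<Rightarrow> 'a \<Rightarrow> real) \<Rightarrow> 'b \<Rightarrow> bool" where
  "strictly_AMMC_below_at M \<psi> X F w \<alpha> x0 \<longleftrightarrow>
     (\<exists>\<delta>>0. \<forall>i\<ge>1. AE \<omega> in M. \<forall>t\<in>sample_support \<psi> i \<omega>. \<forall>x\<in>X. \<forall>x'\<in>X.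
        0 < norm (x - x') \<and> norm (x - x') < \<delta> \<longrightarrow>
        F x t - F x' t \<ge> - \<alpha> i \<omega> t * w (norm (x - x')))"

definition strictly_AMMC_above_at ::
    "'w measure \<Rightarrow> (nat \<Rightarrow> 'w \<Rightarrow> 'a \<Rightarrow> real) \<Rightarrow> 'b::real_normed_vector set \<Rightarrow>
     ('b \<Rightarrow> 'a \<Rightarrow> real) \<Rightarrow> (real \<Rightarrow> real) \<Rightarrow> (nat \<Rightarrow> 'w \<Rightarrow> 'a \<Rightarrow> real) \<Rightarrow> 'b \<Rightarrow> bool" where
  "strictly_AMMC_above_at M \<psi> X F w \<alpha> x0 \<longleftrightarrow>
     strictly_AMMC_below_at M \<psi> X (\<lambda>x t. - F x t) w \<alpha> x0"

definition strictly_AMMC_at ::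
    "'w measure \<Rightarrow> (nat \<Rightarrow> 'w \<Rightarrow> 'a \<Rightarrow> real) \<Rightarrow> 'b::real_normed_vector set \<Rightarrow>
     ('b \<Rightarrow> 'a \<Rightarrow> real) \<Rightarrow> (real \<Rightarrow> real) \<Rightarrow> (nat \<Rightarrow> 'w \<Rightarrow> 'a \<Rightarrow> real) \<Rightarrow> 'b \<Rightarrow> bool" where
  "strictly_AMMC_at M \<psi> X F w \<alpha> x0 \<longleftrightarrow>
     strictly_AMMC_below_at M \<psi> X F w \<alpha> x0 \<and> strictly_AMMC_above_at M \<psi> X F w \<alpha> x0"

definition integral_fun :: "'a::euclidean_space set \<Rightarrow> ('b \<Rightarrow> 'a \<Rightarrow> real) \<Rightarrow> 'b \<Rightarrow> real" where
  "integral_fun \<Theta> F x = (LINT t:\<Theta>|lborel. F x t)"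

definition sample_average ::
    "(nat \<Rightarrow> 'w \<Rightarrow> 'a) \<Rightarrow> (nat \<Rightarrow> 'w \<Rightarrow> 'a \<Rightarrow> real) \<Rightarrow> ('b \<Rightarrow> 'a \<Rightarrow> real) \<Rightarrow>
     nat \<Rightarrow> 'b \<Rightarrow> 'w \<Rightarrow> real" where
  "sample_average \<theta> \<psi> F n x \<omega> =
     1 / real n * (\<Sum>i=1..n. F x (\<theta> i \<omega>) / \<psi> i \<omega> (\<theta> i \<omega>))"

definition H_dev ::
    "'a::euclidean_space set \<Rightarrow> (nat \<Rightarrow> 'w \<Rightarrow> 'a) \<Rightarrow> (nat \<Rightarrow> 'w \<Rightarrow> 'a \<Rightarrow> real) \<Rightarrow>
     ('b \<Rightarrow> 'a \<Rightarrow> real) \<Rightarrow> nat \<Rightarrow> 'b \<Rightarrow> 'w \<Rightarrow> real" where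
  "H_dev \<Theta> \<theta> \<psi> F n x \<omega> = sample_average \<theta> \<psi> F n x \<omega> - integral_fun \<Theta> F x"

definition A_avg ::
    "(nat \<Rightarrow> 'w \<Rightarrow> 'a) \<Rightarrow> (nat \<Rightarrow> 'w \<Rightarrow> 'a \<Rightarrow> real) \<Rightarrow> (nat \<Rightarrow> 'w \<Rightarrow> 'a \<Rightarrow> real) \<Rightarrow>
     nat \<Rightarrow> 'w \<Rightarrow> real" where
  "A_avg \<theta> \<psi> \<alpha> n \<omega> =
     1 / real n * (\<Sum>i=1..n. \<alpha> i \<omega> (\<theta> i \<omega>) / \<psi> i \<omega> (\<theta> i \<omega>))"

definition coefficient_tail ::
    "'w measure \<Rightarrow> (nat \<Rightarrow> 'w \<Rightarrow> 'a) \<Rightarrow> (nat \<Rightarrow> 'w \<Rightarrow> 'a \<Rightarrow> real) \<Rightarrow>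
     (nat \<Rightarrow> 'w \<Rightarrow> 'a \<Rightarrow> real) \<Rightarrow> bool" where
  "coefficient_tail M \<theta> \<psi> \<alpha> \<longleftrightarrow>
     (\<forall>\<epsilon>>0. \<exists>K>0. \<exists>\<tau>>0. \<forall>n\<ge>1.
        measure M {\<omega> \<in> space M. A_avg \<theta> \<psi> \<alpha> n \<omega> \<ge> \<epsilon> * K} \<le> exp (- (real n * \<tau>)))"

text \<open>Events defined by an uncountable supremum over \<open>X\<close> agree with a measurable event only up to
  a null set, so their probability is taken in the completion of \<open>M\<close>. Their measurability is part
  of the claim, because \<open>measure\<close> is 0 on non-measurable sets.\<close>

definition exponentially_small :: "'w measure \<Rightarrow> (nat \<Rightarrow> 'w \<Rightarrow> bool) \<Rightarrow> bool" where
  "exponentially_small M P \<longleftrightarrow>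
     (\<exists>l>0. \<exists>g>0. \<forall>n\<ge>1.
        {\<omega> \<in> space M. P n \<omega>} \<in> sets (completion M) \<and>
        measure (completion M) {\<omega> \<in> space M. P n \<omega>} \<le> l * exp (- (real n * g)))"

end

theory Submission
  imports Defs
begin

text \<open>The strict calmness condition is a bound on \<open>F x t - F x' t\<close> for all pairs \<open>x, x'\<close> that are
  close, so exchanging \<open>x\<close> and \<open>x'\<close> turns the bound from below into one from above with the same
  coefficient (\<open>AMMC_below_two_sided\<close>, \<open>AMMC_above_two_sided\<close>). Under each of the three hypotheses
  \<open>F\<close> thus satisfies the same two-sided estimate. Almost surely no sample falls where its own
  density vanishes, so the estimate may be divided by the densities and averaged: nearby values of
  the sample average differ by at most \<open>A_avg\<close> times the modulus of the distance
  (\<open>sample_average_modulus\<close>). In particular \<open>H_dev\<close> is almost surely continuous on \<open>X\<close>, which is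
  why its supremum is a supremum over a countable dense set and the events are measurable in the
  completion. As the events of the first two parts are contained in that of the third, a
  bound on the supremum of \<open>\<bar>H_dev\<bar>\<close> gives everything.

  For a fixed \<open>x\<close>, the conditional density makes the summands
  \<open>F x (\<theta> i) / \<psi> i (\<theta> i) - f x\<close> martingale differences: conditionally on the past, the mean of the
  quotient is \<open>\<integral> \<psi> i t * (F x t / \<psi> i t) dt = f x\<close>, where cancelling \<open>\<psi> i\<close> is harmless because \<open>F x\<close>
  vanishes wherever \<open>\<psi> i\<close> does. They are bounded by a constant, so an inequality of
  Azuma--Hoeffding type gives exponential decay of the deviation at \<open>x\<close>
  (\<open>H_dev_exponentially_small\<close>).

  Compactness passes from points to the supremum (\<open>uniform_deviation_exponentially_small\<close>): outside
  the exponentially small event \<open>K \<le> A_avg\<close>, both the sample average and \<open>f\<close> vary little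
  on balls of a fixed small radius, and finitely many such balls cover \<open>X\<close>. The supremum can then
  be large only if the deviation is already large at one of finitely many centres.\<close>

section \<open>Sampling from a conditional density\<close>

lemma sets_restr_to_subalg_pair_lborel:
  "subalgebra M G \<Longrightarrow> sets (restr_to_subalg M G \<Otimes>\<^sub>M lborel) = sets (G \<Otimes>\<^sub>M borel)"
  by (intro sets_pair_measure_cong sets_restr_to_subalg sets_lborel)

lemma measurable_graph:
  assumes sub: "subalgebra M G" and Y: "Y \<in> borel_measurable M"
  shows "(\<lambda>\<omega>. (\<omega>, Y \<omega>)) \<in> measurable M (G \<Otimes>\<^sub>M borel)"
proof -
  have "(\<lambda>\<omega>. \<omega>) \<in> measurable M G" using sub by (rule measurable_from_subalg) simp
  then show ?thesis using Y by simp
qed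

text \<open>The defining property of a conditional density speaks only of sets \<open>B\<close> in the range of \<open>Y\<close>, each
  with its own null set. Integrated over sets \<open>A\<close> of \<open>G\<close> it says that two finite measures agree on
  the rectangles \<open>A \<times> B\<close>. These generate the product \<open>\<sigma>\<close>-algebra, and from the resulting equality of measures
  all later properties follow without returning to the null sets of single \<open>B\<close>.\<close>

lemma (in prob_space) joint_law_eq_density:
  fixes Y :: "'a \<Rightarrow> 'b::euclidean_space"
  assumes sub: "subalgebra M G" and Y[measurable]: "Y \<in> borel_measurable M"
    and cd: "conditional_density M G Y p"
  shows "distr M (G \<Otimes>\<^sub>M borel) (\<lambda>\<omega>. (\<omega>, Y \<omega>)) =
         density (restr_to_subalg M G \<Otimes>\<^sub>M lborel) (\<lambda>(\<omega>, t). ennreal (p \<omega> t))" (is "?L = ?R")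
proof -
  interpret finite_measure_subalgebra M G
    by unfold_locales (rule sub)
  have sp: "space G = space M" and GM: "sets G \<subseteq> sets M" using sub by (auto simp: subalgebra_def)
  let ?N = "restr_to_subalg M G"
  have pm: "(\<lambda>(\<omega>, t). p \<omega> t) \<in> borel_measurable (G \<Otimes>\<^sub>M borel)"
    and p0: "\<And>\<omega> t. \<omega> \<in> space M \<Longrightarrow> 0 \<le> p \<omega> t"
    and ce: "\<And>B. B \<in> sets borel \<Longrightarrow> AE \<omega> in M.
        real_cond_exp M G (\<lambda>\<omega>. indicator B (Y \<omega>)) \<omega> = (LINT t:B|lborel. p \<omega> t)"
    using cd by (auto simp: conditional_density_def)
  have sP: "sets (?N \<Otimes>\<^sub>M lborel) = sets (G \<Otimes>\<^sub>M borel)"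
    by (rule sets_restr_to_subalg_pair_lborel[OF sub])
  have pm'[measurable]: "(\<lambda>(\<omega>, t). ennreal (p \<omega> t)) \<in> borel_measurable (?N \<Otimes>\<^sub>M lborel)"
    using pm by (simp add: measurable_cong_sets[OF sP refl] case_prod_unfold)
  have Lm: "(\<lambda>\<omega>. (\<omega>, Y \<omega>)) \<in> measurable M (G \<Otimes>\<^sub>M borel)"
    by (rule measurable_graph[OF sub Y])
  have intp: "AE \<omega> in M. integrable lborel (p \<omega>)"
  proof -
    have "AE \<omega> in M. real_cond_exp M G (\<lambda>\<omega>. indicator UNIV (Y \<omega>)) \<omega> = 1"
      using real_cond_exp_F_meas[of "\<lambda>_. 1"] by simp
    moreover have "AE \<omega> in M. real_cond_exp M G (\<lambda>\<omega>. indicator UNIV (Y \<omega>)) \<omega> = (LINT t:UNIV|lborel. p \<omega> t)"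
      by (rule ce) simp
    ultimately show ?thesis
    proof (eventually_elim)
      case (elim \<omega>)
      then have "(LINT t|lborel. p \<omega> t) = 1" by (simp add: set_lebesgue_integral_def)
      then show ?case using not_integrable_integral_eq by fastforce
    qed
  qed
  have rect: "emeasure ?L (A \<times> B) = emeasure ?R (A \<times> B)"
    if A: "A \<in> sets G" and B[measurable]: "B \<in> sets borel" for A B
  proof -
    have AM[measurable]: "A \<in> sets M" using A GM by auto
    have Asp: "A \<subseteq> space M" using AM sets.sets_into_space by blast
    have AB: "A \<times> B \<in> sets (G \<Otimes>\<^sub>M borel)" using A B by simp
    let ?g = "\<lambda>\<omega>. indicator B (Y \<omega>) :: real"
    have ig: "integrable M ?g"
      by (rule integrable_const_bound[of _ 1]) (auto simp: indicator_def)
    have ir: "integrable M (\<lambda>\<omega>. indicator A \<omega> * real_cond_exp M G ?g \<omega>)"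
      using integrable_mult_indicator[OF AM real_cond_exp_int(1)[OF ig]] by simp
    have inner: "AE \<omega> in M. (\<integral>\<^sup>+ t. ennreal (p \<omega> t) * indicator (A \<times> B) (\<omega>, t) \<partial>lborel)
        = ennreal (indicator A \<omega> * real_cond_exp M G ?g \<omega>)"
      using ce[OF B] intp
    proof (eventually_elim, goal_cases)
      case (1 \<omega>)
      show ?case
      proof (cases "\<omega> \<in> A")
        case True
        then have w: "\<omega> \<in> space M" using Asp by auto
        have i: "integrable lborel (\<lambda>t. indicator B t * p \<omega> t)"
          using integrable_mult_indicator[of B lborel "p \<omega>"] 1 by simp
        have "(\<integral>\<^sup>+ t. ennreal (p \<omega> t) * indicator (A \<times> B) (\<omega>, t) \<partial>lborel)
           = (\<integral>\<^sup>+ t. ennreal (indicator B t * p \<omega> t) \<partial>lborel)"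
          using True by (intro nn_integral_cong) (auto simp: indicator_def)
        also have "\<dots> = ennreal (LINT t|lborel. indicator B t * p \<omega> t)"
          using i p0[OF w] by (intro nn_integral_eq_integral) auto
        finally show ?thesis using 1 True by (simp add: set_lebesgue_integral_def)
      qed simp
    qed
    have pos: "AE \<omega> in M. 0 \<le> indicator A \<omega> * real_cond_exp M G ?g \<omega>"
    proof -
      have "AE \<omega> in M. real_cond_exp M G ?g \<omega> \<ge> 0"
        by (rule real_cond_exp_pos) auto
      then show ?thesis by eventually_elim (auto simp: indicator_def)
    qed
    have nm: "(\<lambda>\<omega>. \<integral>\<^sup>+ t. ennreal (p \<omega> t) * indicator (A \<times> B) (\<omega>, t) \<partial>lborel) \<in> borel_measurable G"
    proof -
      have "(\<lambda>(\<omega>, t). ennreal (p \<omega> t) * indicator (A \<times> B) (\<omega>, t)) \<in> borel_measurable (G \<Otimes>\<^sub>M lborel)"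
        using pm A B by (simp add: case_prod_unfold)
      then show ?thesis
        using lborel.borel_measurable_nn_integral by blast
    qed
    have "emeasure ?R (A \<times> B) = (\<integral>\<^sup>+ z. (case z of (\<omega>, t) \<Rightarrow> ennreal (p \<omega> t)) * indicator (A \<times> B) z \<partial>(?N \<Otimes>\<^sub>M lborel))"
      by (rule emeasure_density[OF pm']) (simp only: sP AB)
    also have "\<dots> = (\<integral>\<^sup>+ \<omega>. \<integral>\<^sup>+ t. ennreal (p \<omega> t) * indicator (A \<times> B) (\<omega>, t) \<partial>lborel \<partial>?N)"
      by (subst lborel.nn_integral_fst[symmetric])
         (auto intro!: borel_measurable_times_ennreal pm' borel_measurable_indicator simp only: sP AB case_prod_conv)
    also have "\<dots> = (\<integral>\<^sup>+ \<omega>. \<integral>\<^sup>+ t. ennreal (p \<omega> t) * indicator (A \<times> B) (\<omega>, t) \<partial>lborel \<partial>M)"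
      using nn_integral_subalgebra2[OF sub nm] .
    also have "\<dots> = (\<integral>\<^sup>+ \<omega>. ennreal (indicator A \<omega> * real_cond_exp M G ?g \<omega>) \<partial>M)"
      by (rule nn_integral_cong_AE[OF inner])
    also have "\<dots> = ennreal (LINT \<omega>|M. indicator A \<omega> * real_cond_exp M G ?g \<omega>)"
      by (rule nn_integral_eq_integral[OF ir pos])
    also have "(LINT \<omega>|M. indicator A \<omega> * real_cond_exp M G ?g \<omega>) = (LINT \<omega>|M. indicator A \<omega> * ?g \<omega>)"
      using real_cond_exp_intA[OF ig A] by (simp add: set_lebesgue_integral_def)
    also have "\<dots> = (LINT \<omega>|M. indicator (A \<inter> (Y -` B \<inter> space M)) \<omega>)"
      using Asp by (intro Bochner_Integration.integral_cong) (auto simp: indicator_def)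
    also have "ennreal \<dots> = emeasure M (A \<inter> (Y -` B \<inter> space M))"
      by (simp add: emeasure_eq_measure)
    also have "\<dots> = emeasure ?L (A \<times> B)"
      using AB Asp by (subst emeasure_distr[OF Lm]) (auto intro!: arg_cong[of _ _ "emeasure M"])
    finally show ?thesis by simp
  qed
  show ?thesis
  proof (rule measure_eqI_generator_eq[OF Int_stable_pair_measure_generator[of G borel]])
    show "{a \<times> b | a b. a \<in> sets G \<and> b \<in> sets borel} \<subseteq> Pow (space G \<times> (UNIV::'b set))"
      using sets.sets_into_space by auto
    show "emeasure ?L Z = emeasure ?R Z" if "Z \<in> {a \<times> b | a b. a \<in> sets G \<and> b \<in> sets borel}" for Z
      using that rect by auto
    show "sets ?L = sigma_sets (space G \<times> UNIV) {a \<times> b | a b. a \<in> sets G \<and> b \<in> sets borel}"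
      by (simp add: sets_pair_measure)
    show "sets ?R = sigma_sets (space G \<times> UNIV) {a \<times> b | a b. a \<in> sets G \<and> b \<in> sets borel}"
      using sP by (simp add: sets_pair_measure)
    show "range (\<lambda>_::nat. space G \<times> (UNIV::'b set)) \<subseteq> {a \<times> b | a b. a \<in> sets G \<and> b \<in> sets borel}"
      by (auto intro!: exI[of _ "space G"] exI[of _ "UNIV::'b set"])
    show "(\<Union>i::nat. space G \<times> (UNIV::'b set)) = space G \<times> UNIV" by simp
    have "prob_space ?L" by (rule prob_space_distr[OF Lm])
    then interpret L: prob_space ?L .
    show "emeasure ?L (space G \<times> UNIV) \<noteq> \<infinity>" by simp
  qed
qed

text \<open>Sampling freezes the past: in the conditional expectation of \<open>h \<omega> (Y \<omega>)\<close> the first argument of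
  \<open>h\<close> is a constant and the second is integrated against the density. This is Fubini's theorem
  for the joint law.\<close>

lemma (in prob_space) conditional_expectation_of_sample:
  fixes Y :: "'a \<Rightarrow> 'b::euclidean_space" and h :: "'a \<Rightarrow> 'b \<Rightarrow> real"
  assumes sub: "subalgebra M G" and Y[measurable]: "Y \<in> borel_measurable M"
    and cd: "conditional_density M G Y p"
    and hm: "(\<lambda>(\<omega>, t). h \<omega> t) \<in> borel_measurable (G \<Otimes>\<^sub>M borel)"
    and hi: "integrable M (\<lambda>\<omega>. h \<omega> (Y \<omega>))"
  shows "AE \<omega> in M. real_cond_exp M G (\<lambda>\<omega>. h \<omega> (Y \<omega>)) \<omega> = (LINT t|lborel. p \<omega> t * h \<omega> t)"
proof -
  interpret finite_measure_subalgebra M G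
    by unfold_locales (rule sub)
  let ?N = "restr_to_subalg M G"
  interpret N: finite_measure ?N by (rule finite_measure_restr_to_subalg[OF sub]) unfold_locales
  interpret P: pair_sigma_finite ?N "lborel :: 'b measure" by unfold_locales
  have sp: "space G = space M" and GM: "sets G \<subseteq> sets M" using sub by (auto simp: subalgebra_def)
  have pm: "(\<lambda>(\<omega>, t). p \<omega> t) \<in> borel_measurable (G \<Otimes>\<^sub>M borel)"
    and p0: "\<And>\<omega> t. \<omega> \<in> space M \<Longrightarrow> 0 \<le> p \<omega> t"
    using cd by (auto simp: conditional_density_def)
  have sR: "sets ?N = sets G" by (rule sets_restr_to_subalg[OF sub])
  have sP: "sets (?N \<Otimes>\<^sub>M lborel) = sets (G \<Otimes>\<^sub>M borel)"
    by (rule sets_restr_to_subalg_pair_lborel[OF sub])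
  have Lm: "(\<lambda>\<omega>. (\<omega>, Y \<omega>)) \<in> measurable M (G \<Otimes>\<^sub>M borel)"
    by (rule measurable_graph[OF sub Y])
  have key: "integrable (?N \<Otimes>\<^sub>M lborel) (\<lambda>(\<omega>, t). indicator A \<omega> * (p \<omega> t * h \<omega> t)) \<and>
       (LINT \<omega>|M. indicator A \<omega> * h \<omega> (Y \<omega>)) = 
       (LINT z|(?N \<Otimes>\<^sub>M lborel). (case z of (\<omega>, t) \<Rightarrow> indicator A \<omega> * (p \<omega> t * h \<omega> t)))"
    if A: "A \<in> sets G" for A
  proof -
    let ?k = "\<lambda>(\<omega>, t). indicator A \<omega> * h \<omega> t"
    have AM: "A \<in> sets M" using A GM by auto
    have km: "?k \<in> borel_measurable (G \<Otimes>\<^sub>M borel)"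
      using hm A by (simp add: case_prod_unfold)
    have km': "?k \<in> borel_measurable (?N \<Otimes>\<^sub>M lborel)" and pm': "(\<lambda>(\<omega>, t). p \<omega> t) \<in> borel_measurable (?N \<Otimes>\<^sub>M lborel)"
      using km pm by (simp_all add: measurable_cong_sets[OF sP refl])
    have nn: "AE z in ?N \<Otimes>\<^sub>M lborel. 0 \<le> (case z of (\<omega>, t) \<Rightarrow> p \<omega> t)"
      using p0 by (intro AE_I2) (auto simp: space_pair_measure space_restr_to_subalg)
    have e: "(\<lambda>(\<omega>, t). ennreal (p \<omega> t)) = (\<lambda>z. ennreal (case z of (\<omega>, t) \<Rightarrow> p \<omega> t))" by auto
    have "integrable M (\<lambda>\<omega>. ?k (\<omega>, Y \<omega>))"
      using integrable_mult_indicator[OF AM hi] by simp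
    then have "integrable (distr M (G \<Otimes>\<^sub>M borel) (\<lambda>\<omega>. (\<omega>, Y \<omega>))) ?k"
      by (subst integrable_distr_eq[OF Lm km])
    then have "integrable (?N \<Otimes>\<^sub>M lborel) (\<lambda>z. (case z of (\<omega>, t) \<Rightarrow> p \<omega> t) *\<^sub>R ?k z)"
      unfolding joint_law_eq_density[OF sub Y cd] e
      by (subst (asm) integrable_density[OF km' pm' nn])
    moreover have "(LINT \<omega>|M. ?k (\<omega>, Y \<omega>)) = (LINT z|(?N \<Otimes>\<^sub>M lborel). (case z of (\<omega>, t) \<Rightarrow> p \<omega> t) *\<^sub>R ?k z)"
      unfolding integral_distr[OF Lm km, symmetric] joint_law_eq_density[OF sub Y cd] e
      by (rule integral_density[OF km' pm' nn])
    moreover have "(\<lambda>z. (case z of (\<omega>, t) \<Rightarrow> p \<omega> t) *\<^sub>R ?k z) = (\<lambda>(\<omega>, t). indicator A \<omega> * (p \<omega> t * h \<omega> t))"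
      by (auto simp: fun_eq_iff)
    ultimately show ?thesis by simp
  qed
  let ?J = "\<lambda>\<omega>. LINT t|lborel. p \<omega> t * h \<omega> t"
  have i1: "integrable (?N \<Otimes>\<^sub>M lborel) (\<lambda>(\<omega>, t). p \<omega> t * h \<omega> t)"
  proof -
    have "integrable (?N \<Otimes>\<^sub>M lborel) (\<lambda>(\<omega>, t). indicator (space G) \<omega> * (p \<omega> t * h \<omega> t))"
      using key[of "space G"] by auto
    then show ?thesis
      by (rule Bochner_Integration.integrable_cong[THEN iffD1, rotated 2])
         (auto simp: space_pair_measure space_restr_to_subalg sp)
  qed
  have JR: "integrable ?N ?J"
    using P.integrable_fst'[OF i1] by simp
  have Jm: "?J \<in> borel_measurable G"
    using borel_measurable_integrable[OF JR] measurable_cong_sets[OF sR refl] by blast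
  show ?thesis
  proof (rule real_cond_exp_charact[OF _ hi _ Jm])
    show "integrable M ?J" by (rule integrable_from_subalg[OF sub JR])
    fix A assume A: "A \<in> sets G"
    have "(LINT \<omega>:A|M. h \<omega> (Y \<omega>)) = 
       (LINT z|(?N \<Otimes>\<^sub>M lborel). (case z of (\<omega>, t) \<Rightarrow> indicator A \<omega> * (p \<omega> t * h \<omega> t)))"
      using key[OF A] by (simp add: set_lebesgue_integral_def)
    also have "\<dots> = (LINT \<omega>|?N. LINT t|lborel. indicator A \<omega> * (p \<omega> t * h \<omega> t))"
      using P.integral_fst'[OF conjunct1[OF key[OF A]]] by simp
    also have "\<dots> = (LINT \<omega>|?N. indicator A \<omega> * ?J \<omega>)" by simp
    also have "\<dots> = (LINT \<omega>|M. indicator A \<omega> * ?J \<omega>)"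
      using A Jm by (intro integral_subalgebra2[OF sub]) simp
    finally show "(LINT \<omega>:A|M. h \<omega> (Y \<omega>)) = (LINT \<omega>:A|M. ?J \<omega>)"
      by (simp add: set_lebesgue_integral_def)
  qed
qed

text \<open>The set where the density vanishes is null for the joint law. This justifies dividing by
  \<open>p \<omega> (Y \<omega>)\<close> in importance sampling.\<close>

lemma (in prob_space) density_at_sample_nonzero:
  fixes Y :: "'a \<Rightarrow> 'b::euclidean_space"
  assumes sub: "subalgebra M G" and Y[measurable]: "Y \<in> borel_measurable M"
    and cd: "conditional_density M G Y p"
  shows "AE \<omega> in M. p \<omega> (Y \<omega>) \<noteq> 0"
proof -
  let ?N = "restr_to_subalg M G"
  have sP: "sets (?N \<Otimes>\<^sub>M lborel) = sets (G \<Otimes>\<^sub>M borel)"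
    by (rule sets_restr_to_subalg_pair_lborel[OF sub])
  have pm: "(\<lambda>(\<omega>, t). p \<omega> t) \<in> borel_measurable (G \<Otimes>\<^sub>M borel)"
    using cd by (auto simp: conditional_density_def)
  have Lm: "(\<lambda>\<omega>. (\<omega>, Y \<omega>)) \<in> measurable M (G \<Otimes>\<^sub>M borel)"
    by (rule measurable_graph[OF sub Y])
  have "AE z in distr M (G \<Otimes>\<^sub>M borel) (\<lambda>\<omega>. (\<omega>, Y \<omega>)). (\<lambda>(\<omega>, t). p \<omega> t) z \<noteq> 0"
    unfolding joint_law_eq_density[OF sub Y cd]
    using pm by (subst AE_density) (auto simp: measurable_cong_sets[OF sP refl] case_prod_unfold intro!: AE_I2)
  moreover have "{z \<in> space (G \<Otimes>\<^sub>M borel). (\<lambda>(\<omega>, t). p \<omega> t) z \<noteq> 0} \<in> sets (G \<Otimes>\<^sub>M borel)"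
    using pm by measurable
  ultimately show ?thesis
    using AE_distr_iff[OF Lm, of "\<lambda>z. (\<lambda>(\<omega>, t). p \<omega> t) z \<noteq> 0"] by simp
qed

section \<open>Exponential bounds for bounded martingale differences\<close>

lemma exp_le_quadratic:
  fixes y :: real
  assumes "\<bar>y\<bar> \<le> 1"
  shows "exp y \<le> 1 + y + y\<^sup>2"
proof (cases "0 \<le> y")
  case True
  then show ?thesis using exp_bound[of y] assms by simp
next
  case False
  define u where "u = - y"
  have u: "0 < u" using False by (simp add: u_def)
  have "1 \<le> (1 - u + u\<^sup>2) * (1 + u)"
  proof -
    have "(1 - u + u\<^sup>2) * (1 + u) = 1 + u ^ 3" by (simp add: algebra_simps power2_eq_square power3_eq_cube)
    then show ?thesis using u by simp
  qed
  also have "\<dots> \<le> (1 - u + u\<^sup>2) * exp u"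
  proof -
    have "0 \<le> 1 - u + u\<^sup>2" using sum_squares_ge_zero[of "u - 1/2" 0] by (simp add: algebra_simps power2_eq_square)
    then show ?thesis using exp_ge_add_one_self by (rule mult_left_mono[rotated])
  qed
  finally have "exp (- u) \<le> 1 - u + u\<^sup>2" by (simp add: exp_minus field_simps)
  then show ?thesis by (simp add: u_def)
qed

text \<open>Each new factor \<open>exp (l * Y n)\<close> is at most \<open>1 + l * Y n + (l * D)\<^sup>2\<close>. Its linear part has
  conditional mean zero, hence disappears against the earlier factors, which are measurable with
  respect to the past, and every step multiplies the moment by at most \<open>1 + (l * D)\<^sup>2\<close>.\<close>

lemma (in prob_space) martingale_difference_exp_moment:
  fixes Y :: "nat \<Rightarrow> 'a \<Rightarrow> real"
  assumes sub: "\<And>i. subalgebra M (G i)"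
    and mono: "\<And>i j. i \<le> j \<Longrightarrow> sets (G i) \<subseteq> sets (G j)"
    and Ym: "\<And>i. 1 \<le> i \<Longrightarrow> Y i \<in> borel_measurable (G i)"
    and bd: "\<And>i. 1 \<le> i \<Longrightarrow> AE \<omega> in M. \<bar>Y i \<omega>\<bar> \<le> D"
    and ce: "\<And>i. 1 \<le> i \<Longrightarrow> AE \<omega> in M. real_cond_exp M (G (i - 1)) (Y i) \<omega> = 0"
    and l: "0 \<le> l" "l * D \<le> 1"
  shows "integrable M (\<lambda>\<omega>. exp (l * (\<Sum>i=1..n. Y i \<omega>))) \<and>
         (LINT \<omega>|M. exp (l * (\<Sum>i=1..n. Y i \<omega>))) \<le> exp (real n * (l * D)\<^sup>2)"
proof (induction n)
  case 0
  then show ?case by (simp add: prob_space)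
next
  case (Suc n)
  interpret finite_measure_subalgebra M "G n" by unfold_locales (rule sub)
  let ?Z = "\<lambda>\<omega>. exp (l * (\<Sum>i=1..n. Y i \<omega>))"
  have ZG: "?Z \<in> borel_measurable (G n)"
  proof -
    have "Y i \<in> borel_measurable (G n)" if "i \<in> {1..n}" for i
      using measurable_mono[of borel borel "G i" "G n"] mono[of i n] Ym[of i] sub[of i] sub[of n] that
      by (auto simp: subalgebra_def)
    then show ?thesis by measurable
  qed
  have [measurable]: "Y (Suc n) \<in> borel_measurable M"
    using measurable_from_subalg[OF sub Ym[of "Suc n"]] by simp
  have Zi: "integrable M ?Z" and Zb: "(LINT \<omega>|M. ?Z \<omega>) \<le> exp (real n * (l * D)\<^sup>2)"
    using Suc by auto
  have Z[measurable]: "?Z \<in> borel_measurable M" using measurable_from_subalg[OF sub ZG] .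
  have bdS: "AE \<omega> in M. \<bar>Y (Suc n) \<omega>\<bar> \<le> D" using bd[of "Suc n"] by simp
  have ZY: "integrable M (\<lambda>\<omega>. ?Z \<omega> * Y (Suc n) \<omega>)"
  proof (rule Bochner_Integration.integrable_bound[OF integrable_mult_right[OF Zi, of D]])
    show "AE \<omega> in M. norm (?Z \<omega> * Y (Suc n) \<omega>) \<le> norm (D * ?Z \<omega>)"
      using bdS by eventually_elim (auto simp: abs_mult mult.commute)
  qed measurable
  have ZY0: "(LINT \<omega>|M. ?Z \<omega> * Y (Suc n) \<omega>) = 0"
  proof -
    have "(LINT \<omega>|M. ?Z \<omega> * Y (Suc n) \<omega>) = (LINT \<omega>|M. ?Z \<omega> * real_cond_exp M (G n) (Y (Suc n)) \<omega>)"
      by (rule real_cond_exp_intg(2)[OF ZY ZG, symmetric]) measurable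
    also have "\<dots> = (LINT \<omega>|M. 0)"
    proof (rule integral_cong_AE)
      show "AE \<omega> in M. ?Z \<omega> * real_cond_exp M (G n) (Y (Suc n)) \<omega> = 0"
        using ce[of "Suc n"] by simp
    qed measurable
    finally show ?thesis by simp
  qed
  have le: "AE \<omega> in M. exp (l * (\<Sum>i=1..Suc n. Y i \<omega>)) \<le> (1 + (l * D)\<^sup>2) * ?Z \<omega> + l * (?Z \<omega> * Y (Suc n) \<omega>)"
    using bdS
  proof eventually_elim
    case (elim \<omega>)
    have 1: "\<bar>l * Y (Suc n) \<omega>\<bar> \<le> l * D" using elim l by (auto simp: abs_mult mult_left_mono)
    then have "exp (l * Y (Suc n) \<omega>) \<le> 1 + l * Y (Suc n) \<omega> + (l * Y (Suc n) \<omega>)\<^sup>2"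
      using l by (intro exp_le_quadratic) simp
    also have "(l * Y (Suc n) \<omega>)\<^sup>2 \<le> (l * D)\<^sup>2"
      using 1 by (metis abs_ge_zero power2_abs power_mono)
    finally have "?Z \<omega> * exp (l * Y (Suc n) \<omega>) \<le> ?Z \<omega> * (1 + l * Y (Suc n) \<omega> + (l * D)\<^sup>2)"
      by simp
    then show ?case by (simp add: distrib_left exp_add algebra_simps)
  qed
  have ri: "integrable M (\<lambda>\<omega>. (1 + (l * D)\<^sup>2) * ?Z \<omega> + l * (?Z \<omega> * Y (Suc n) \<omega>))"
    using Zi ZY by simp
  have Em: "(\<lambda>\<omega>. exp (l * (\<Sum>i=1..Suc n. Y i \<omega>))) \<in> borel_measurable M"
  proof -
    have "(\<lambda>\<omega>. exp (l * (\<Sum>i=1..Suc n. Y i \<omega>))) = (\<lambda>\<omega>. ?Z \<omega> * exp (l * Y (Suc n) \<omega>))"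
      by (simp add: distrib_left exp_add)
    moreover have "(\<lambda>\<omega>. ?Z \<omega> * exp (l * Y (Suc n) \<omega>)) \<in> borel_measurable M"
      by (intro borel_measurable_times Z) measurable
    ultimately show ?thesis by simp
  qed
  have Ei: "integrable M (\<lambda>\<omega>. exp (l * (\<Sum>i=1..Suc n. Y i \<omega>)))"
    by (rule Bochner_Integration.integrable_bound[OF ri Em]) (use le in \<open>eventually_elim, simp\<close>)
  have "(LINT \<omega>|M. exp (l * (\<Sum>i=1..Suc n. Y i \<omega>))) \<le>
        (LINT \<omega>|M. (1 + (l * D)\<^sup>2) * ?Z \<omega> + l * (?Z \<omega> * Y (Suc n) \<omega>))"
    by (rule integral_mono_AE[OF Ei ri le])
  also have "\<dots> = (1 + (l * D)\<^sup>2) * (LINT \<omega>|M. ?Z \<omega>)"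
    using Zi ZY ZY0 by simp
  also have "\<dots> \<le> exp ((l * D)\<^sup>2) * exp (real n * (l * D)\<^sup>2)"
    using Zb by (intro mult_mono exp_ge_add_one_self) auto
  also have "\<dots> = exp (real (Suc n) * (l * D)\<^sup>2)"
    by (simp add: exp_add[symmetric] algebra_simps)
  finally show ?case using Ei by simp
qed

text \<open>Markov's inequality for the exponential moment, with the \<open>l\<close> that minimises
  \<open>(l * D)\<^sup>2 - l * \<epsilon>\<close>. The elementary estimate of \<open>exp\<close> on \<open>[-1, 1]\<close> costs a factor 2 in
  the exponent compared with the optimal constant, and it is why \<open>\<epsilon> \<le> 2 * D\<close> is required.\<close>

lemma (in prob_space) azuma_hoeffding:
  fixes Y :: "nat \<Rightarrow> 'a \<Rightarrow> real"
  assumes sub: "\<And>i. subalgebra M (G i)"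
    and mono: "\<And>i j. i \<le> j \<Longrightarrow> sets (G i) \<subseteq> sets (G j)"
    and Ym: "\<And>i. 1 \<le> i \<Longrightarrow> Y i \<in> borel_measurable (G i)"
    and bd: "\<And>i. 1 \<le> i \<Longrightarrow> AE \<omega> in M. \<bar>Y i \<omega>\<bar> \<le> D"
    and ce: "\<And>i. 1 \<le> i \<Longrightarrow> AE \<omega> in M. real_cond_exp M (G (i - 1)) (Y i) \<omega> = 0"
    and D: "0 < D" and e: "0 < \<epsilon>" "\<epsilon> \<le> 2 * D"
  shows "prob {\<omega> \<in> space M. real n * \<epsilon> \<le> (\<Sum>i=1..n. Y i \<omega>)} \<le> exp (- (real n * (\<epsilon> / (2 * D))\<^sup>2))"
proof -
  define l where "l = \<epsilon> / (2 * D\<^sup>2)"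
  have lD: "l * D = \<epsilon> / (2 * D)" using D by (simp add: l_def power2_eq_square)
  have l: "0 < l" "l * D \<le> 1" using D e unfolding lD by (auto simp: l_def)
  have le: "l * \<epsilon> = 2 * (l * D)\<^sup>2" using D by (simp add: lD) (simp add: l_def power2_eq_square)
  let ?E = "\<lambda>\<omega>. exp (l * (\<Sum>i=1..n. Y i \<omega>))"
  have E: "integrable M ?E" "(LINT \<omega>|M. ?E \<omega>) \<le> exp (real n * (l * D)\<^sup>2)"
    using martingale_difference_exp_moment[where G=G and Y=Y and D=D and l=l and n=n] assms l by auto
  have "{\<omega> \<in> space M. real n * \<epsilon> \<le> (\<Sum>i=1..n. Y i \<omega>)} =
        {\<omega> \<in> space M. exp (l * (real n * \<epsilon>)) \<le> ?E \<omega>}"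
    using l by auto
  also have "prob \<dots> \<le> (LINT \<omega>|M. ?E \<omega>) / exp (l * (real n * \<epsilon>))"
    using E(1) by (intro integral_Markov_inequality_measure[where A="{}"]) auto
  also have "\<dots> \<le> exp (real n * (l * D)\<^sup>2) / exp (l * (real n * \<epsilon>))"
    using E(2) by (intro divide_right_mono) auto
  also have "\<dots> = exp (real n * (l * D)\<^sup>2 - real n * (l * \<epsilon>))"
    by (simp add: exp_diff algebra_simps)
  also have "real n * (l * D)\<^sup>2 - real n * (l * \<epsilon>) = - (real n * (l * D)\<^sup>2)"
    unfolding le by simp
  finally show ?thesis by (simp only: lD)
qed

section \<open>Exponentially small events\<close>

lemma exponentially_smallI:
  assumes "l > 0" "g > 0"
    and "\<And>n. n \<ge> 1 \<Longrightarrow> {\<omega> \<in> space M. P n \<omega>} \<in> sets M"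
    and "\<And>n. n \<ge> 1 \<Longrightarrow> measure M {\<omega> \<in> space M. P n \<omega>} \<le> l * exp (- (real n * g))"
  shows "exponentially_small M P"
  unfolding exponentially_small_def
  using assms by (intro exI[of _ l] conjI exI[of _ g] allI impI) auto

lemma (in prob_space) exponentially_small_mono_AE:
  assumes P: "exponentially_small M P"
    and Q: "\<And>n. n \<ge> 1 \<Longrightarrow> {\<omega> \<in> space M. Q n \<omega>} \<in> sets (completion M)"
    and QP: "\<And>n. n \<ge> 1 \<Longrightarrow> AE \<omega> in M. Q n \<omega> \<longrightarrow> P n \<omega>"
  shows "exponentially_small M Q"
proof -
  interpret C: prob_space "completion M" by (rule prob_space_completion)
  from P obtain l g where lg: "l > 0" "g > 0"
    and Pn: "\<And>n. n \<ge> 1 \<Longrightarrow> {\<omega> \<in> space M. P n \<omega>} \<in> sets (completion M)"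
    "\<And>n. n \<ge> 1 \<Longrightarrow> measure (completion M) {\<omega> \<in> space M. P n \<omega>} \<le> l * exp (- (real n * g))"
    by (auto simp: exponentially_small_def)
  have "measure (completion M) {\<omega> \<in> space M. Q n \<omega>} \<le> measure (completion M) {\<omega> \<in> space M. P n \<omega>}"
    if "n \<ge> 1" for n
    using AE_completion[OF QP[OF that]] Pn(1)[OF that] by (intro C.finite_measure_mono_AE) auto
  then show ?thesis
    unfolding exponentially_small_def
    using lg Q Pn(2) by (intro exI[of _ l] conjI exI[of _ g] allI impI) (auto intro: order_trans)
qed

lemma (in prob_space) exponentially_small_disj:
  assumes P: "exponentially_small M P" and Q: "exponentially_small M Q"
  shows "exponentially_small M (\<lambda>n \<omega>. P n \<omega> \<or> Q n \<omega>)"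
proof -
  interpret C: prob_space "completion M" by (rule prob_space_completion)
  let ?m = "\<lambda>R n. measure (completion M) {\<omega> \<in> space M. R n \<omega>}"
  from P obtain l g where lg: "l > 0" "g > 0"
    and Pn: "\<And>n. n \<ge> 1 \<Longrightarrow> {\<omega> \<in> space M. P n \<omega>} \<in> sets (completion M)"
    "\<And>n. n \<ge> 1 \<Longrightarrow> ?m P n \<le> l * exp (- (real n * g))"
    by (auto simp: exponentially_small_def)
  from Q obtain l' g' where lg': "l' > 0" "g' > 0"
    and Qn: "\<And>n. n \<ge> 1 \<Longrightarrow> {\<omega> \<in> space M. Q n \<omega>} \<in> sets (completion M)"
    "\<And>n. n \<ge> 1 \<Longrightarrow> ?m Q n \<le> l' * exp (- (real n * g'))"
    by (auto simp: exponentially_small_def)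
  have eq: "{\<omega> \<in> space M. P n \<omega> \<or> Q n \<omega>} = {\<omega> \<in> space M. P n \<omega>} \<union> {\<omega> \<in> space M. Q n \<omega>}" for n
    by auto
  have "?m (\<lambda>n \<omega>. P n \<omega> \<or> Q n \<omega>) n \<le> (l + l') * exp (- (real n * min g g'))" if n: "n \<ge> 1" for n
  proof -
    have "?m (\<lambda>n \<omega>. P n \<omega> \<or> Q n \<omega>) n \<le> ?m P n + ?m Q n"
      unfolding eq using Pn(1)[OF n] Qn(1)[OF n] by (rule measure_Un_le)
    also have "\<dots> \<le> l * exp (- (real n * g)) + l' * exp (- (real n * g'))"
      using Pn(2)[OF n] Qn(2)[OF n] by simp
    also have "\<dots> \<le> l * exp (- (real n * min g g')) + l' * exp (- (real n * min g g'))"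
      using lg lg' by (intro add_mono mult_left_mono) (auto intro!: mult_left_mono)
    finally show ?thesis by (simp add: distrib_right)
  qed
  then show ?thesis
    unfolding exponentially_small_def using lg lg' Pn(1) Qn(1)
    by (intro exI[of _ "l + l'"] conjI exI[of _ "min g g'"] allI impI) (auto simp: eq)
qed

lemma (in prob_space) exponentially_small_finite_Bex:
  assumes "finite J" "\<And>j. j \<in> J \<Longrightarrow> exponentially_small M (P j)"
  shows "exponentially_small M (\<lambda>n \<omega>. \<exists>j\<in>J. P j n \<omega>)"
  using assms
proof (induction J rule: finite_induct)
  case empty
  show ?case by (rule exponentially_smallI[of 1 1]) auto
next
  case (insert j J)
  then show ?case using exponentially_small_disj[of "P j"] by simp
qed

section \<open>Moduli of continuity\<close>

lemma modulus_of_continuity_small: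
  assumes w: "modulus_of_continuity w" and c: "0 < c"
  shows "\<exists>\<eta>>0. \<forall>d. 0 < d \<and> d < \<eta> \<longrightarrow> 0 < w d \<and> w d < c"
proof -
  have sm: "strict_mono_on {0..} w" and co: "continuous_on {0..} w" and t0: "(w \<longlongrightarrow> 0) (at_right 0)"
    using w by (auto simp: modulus_of_continuity_def)
  have "(w \<longlongrightarrow> w 0) (at 0 within {0..})" using co by (auto simp: continuous_on_def)
  then have "(w \<longlongrightarrow> w 0) (at_right 0)" by (rule tendsto_within_subset) auto
  then have w0: "w 0 = 0" using t0 tendsto_unique trivial_limit_at_right_real by blast
  have "eventually (\<lambda>d. w d < c) (at_right 0)" using order_tendstoD(2)[OF t0 c] .
  then obtain \<eta> where "\<eta> > 0" "\<And>d. 0 < d \<Longrightarrow> d < \<eta> \<Longrightarrow> w d < c"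
    unfolding eventually_at_right_field by auto
  then show ?thesis using strict_mono_onD[OF sm, of 0] w0 by (intro exI[of _ \<eta>]) auto
qed

lemma continuous_on_of_modulus:
  fixes h :: "'b::real_normed_vector \<Rightarrow> real"
  assumes w: "modulus_of_continuity w" and d: "0 < \<delta>"
    and h: "\<And>x x'. x \<in> X \<Longrightarrow> x' \<in> X \<Longrightarrow> 0 < norm (x - x') \<Longrightarrow> norm (x - x') < \<delta> \<Longrightarrow>
              \<bar>h x - h x'\<bar> \<le> A * w (norm (x - x'))"
  shows "continuous_on X h"
  unfolding continuous_on_iff
proof (intro ballI allI impI)
  fix x and e :: real assume x: "x \<in> X" and e: "0 < e"
  define c where "c = e / (\<bar>A\<bar> + 1)"
  have c: "0 < c" using e by (auto simp: c_def)
  obtain \<eta> where \<eta>: "\<eta> > 0" "\<And>d. 0 < d \<Longrightarrow> d < \<eta> \<Longrightarrow> 0 < w d \<and> w d < c"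
    using modulus_of_continuity_small[OF w c] by blast
  have "dist (h x') (h x) < e" if x': "x' \<in> X" "dist x' x < min \<delta> \<eta>" for x'
  proof (cases "x' = x")
    case False
    let ?d = "norm (x' - x)"
    have d': "0 < ?d" "?d < \<delta>" "?d < \<eta>" using False x' by (auto simp: dist_norm)
    have "\<bar>h x' - h x\<bar> \<le> A * w ?d" using h[OF x'(1) x d'(1,2)] .
    also have "\<dots> \<le> \<bar>A\<bar> * c" using \<eta>(2)[OF d'(1,3)] by (intro mult_mono) auto
    also have "\<dots> < e" using e by (simp add: c_def field_simps)
    finally show ?thesis by (simp add: dist_real_def)
  qed (use e in simp)
  then show "\<exists>d>0. \<forall>x'\<in>X. dist x' x < d \<longrightarrow> dist (h x') (h x) < e"
    using d \<eta>(1) by (intro exI[of _ "min \<delta> \<eta>"]) auto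
qed

section \<open>Measurability of suprema over uncountable sets\<close>

lemma SUP_continuous_eq_dense:
  fixes h :: "'b::topological_space \<Rightarrow> real"
  assumes h: "continuous_on X h" and T: "T \<subseteq> X" "X \<subseteq> closure T"
  shows "(SUP x\<in>X. ereal (h x)) = (SUP x\<in>T. ereal (h x))"
proof (rule antisym)
  show "(SUP x\<in>T. ereal (h x)) \<le> (SUP x\<in>X. ereal (h x))" using T(1) by (intro SUP_subset_mono) auto
  show "(SUP x\<in>X. ereal (h x)) \<le> (SUP x\<in>T. ereal (h x))"
  proof (rule SUP_least, rule ccontr)
    fix x assume x: "x \<in> X" and "\<not> ereal (h x) \<le> (SUP x\<in>T. ereal (h x))"
    then have "(SUP x\<in>T. ereal (h x)) < ereal (h x)" by simp
    then obtain c :: real where c: "(SUP x\<in>T. ereal (h x)) < ereal c" "c < h x"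
      using ereal_dense2 by force
    obtain U where U: "open U" "U \<inter> X = h -` {c<..} \<inter> X"
      using h c(2) continuous_on_open_invariant[THEN iffD1, rule_format, of X h "{c<..}"] by auto
    have "x \<in> U" using U(2) c(2) x by auto
    moreover have "x \<in> closure T" using x T(2) by auto
    ultimately obtain y where y: "y \<in> T" "y \<in> U"
      using U(1) by (metis Int_iff closure_iff_nhds_not_empty[of x T] equals0I subset_refl)
    then have "c < h y" using U(2) T(1) by auto
    moreover have "ereal (h y) \<le> (SUP x\<in>T. ereal (h x))" using y(1) by (rule SUP_upper)
    ultimately show False using c(1) by (metis ereal_less_eq(3) less_le_not_le order.strict_trans1 order_less_imp_le)
  qed
qed

lemma sets_completion_AE_cong:
  assumes A: "A \<in> sets M" and B: "B \<subseteq> space M" and AB: "AE \<omega> in M. \<omega> \<in> A \<longleftrightarrow> \<omega> \<in> B"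
  shows "B \<in> sets (completion M)"
proof -
  obtain N where N: "N \<in> null_sets M" "{\<omega> \<in> space M. \<not> (\<omega> \<in> A \<longleftrightarrow> \<omega> \<in> B)} \<subseteq> N"
    using AB by (auto elim!: AE_E3 simp: eventually_ae_filter)
  have "B = (A - N) \<union> (B \<inter> N)" using N(2) B sets.sets_into_space[OF A] by blast
  moreover have "A - N \<in> sets M" using A N(1) by auto
  ultimately show ?thesis using N(1) by (intro sets_completionI[of B "A - N" "B \<inter> N" N]) auto
qed

text \<open>On the almost sure event of continuity the supremum may be taken over a countable dense subset of
  \<open>X\<close>, where it is measurable. The two events differ inside a null set, and this null set is the
  reason for passing to the completion.\<close>

lemma SUP_event_in_completion:
  fixes h :: "'b::{metric_space, second_countable_topology} \<Rightarrow> 'w \<Rightarrow> real"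
  assumes hm: "\<And>x. x \<in> X \<Longrightarrow> h x \<in> borel_measurable M"
    and hc: "AE \<omega> in M. continuous_on X (\<lambda>x. h x \<omega>)"
  shows "{\<omega> \<in> space M. c \<le> (SUP x\<in>X. ereal (h x \<omega>))} \<in> sets (completion M)"
proof -
  obtain T where T: "countable T" "T \<subseteq> X" "X \<subseteq> closure T" using separable by blast
  have [measurable]: "(\<lambda>\<omega>. SUP x\<in>T. ereal (h x \<omega>)) \<in> borel_measurable M"
    using T hm by (intro borel_measurable_SUP) (auto intro!: borel_measurable_ereal)
  show ?thesis
  proof (rule sets_completion_AE_cong)
    show "{\<omega> \<in> space M. c \<le> (SUP x\<in>T. ereal (h x \<omega>))} \<in> sets M" by measurable
    show "AE \<omega> in M. \<omega> \<in> {\<omega> \<in> space M. c \<le> (SUP x\<in>T. ereal (h x \<omega>))} \<longleftrightarrow>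
         \<omega> \<in> {\<omega> \<in> space M. c \<le> (SUP x\<in>X. ereal (h x \<omega>))}"
      using hc by eventually_elim (simp add: SUP_continuous_eq_dense[OF _ T(2,3)])
  qed auto
qed

section \<open>From pointwise to uniform deviation bounds\<close>

text \<open>Of the threshold \<open>\<epsilon>\<close>, one quarter each is spent on the deviation at the centre of a ball, on the
  variation of \<open>f\<close> and on the variation of \<open>s n\<close> over the ball. The last quarter makes the
  supremum strictly smaller than \<open>\<epsilon>\<close>.\<close>

lemma (in prob_space) uniform_deviation_exponentially_small:
  fixes s :: "nat \<Rightarrow> 'b::real_normed_vector \<Rightarrow> 'a \<Rightarrow> real"
  assumes X: "compact X" and f: "continuous_on X f"
    and w: "modulus_of_continuity w" and d: "0 < \<delta>"
    and pointwise: "\<And>x \<epsilon>. x \<in> X \<Longrightarrow> 0 < \<epsilon> \<Longrightarrow> exponentially_small M (\<lambda>n \<omega>. \<epsilon> \<le> \<bar>s n x \<omega> - f x\<bar>)"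
    and K: "0 < K" and tail: "exponentially_small M (\<lambda>n \<omega>. K \<le> A n \<omega>)"
    and modulus: "\<And>n. 1 \<le> n \<Longrightarrow> AE \<omega> in M. \<forall>x\<in>X. \<forall>x'\<in>X.
        0 < norm (x - x') \<and> norm (x - x') < \<delta> \<longrightarrow> \<bar>s n x \<omega> - s n x' \<omega>\<bar> \<le> A n \<omega> * w (norm (x - x'))"
    and event: "\<And>n. 1 \<le> n \<Longrightarrow>
        {\<omega> \<in> space M. ereal \<epsilon> \<le> (SUP x\<in>X. ereal \<bar>s n x \<omega> - f x\<bar>)} \<in> sets (completion M)"
    and e: "0 < \<epsilon>"
  shows "exponentially_small M (\<lambda>n \<omega>. ereal \<epsilon> \<le> (SUP x\<in>X. ereal \<bar>s n x \<omega> - f x\<bar>))"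
proof -
  \<comment> \<open>While \<open>A n \<omega> < K\<close>, distances whose modulus is below \<open>c\<close> change \<open>s n\<close> by at most \<open>\<epsilon> / 4\<close>.\<close>
  define c where "c = \<epsilon> / (4 * K)"
  have c: "0 < c" "K * c = \<epsilon> / 4" using K e by (auto simp: c_def)
  obtain \<eta>1 where \<eta>1: "\<eta>1 > 0" "\<And>d. 0 < d \<Longrightarrow> d < \<eta>1 \<Longrightarrow> 0 < w d \<and> w d < c"
    using modulus_of_continuity_small[OF w c(1)] by blast
  have "uniformly_continuous_on X f" using f X by (rule compact_uniformly_continuous)
  then obtain \<eta>2 where \<eta>2: "\<eta>2 > 0"
    "\<And>x x'. x \<in> X \<Longrightarrow> x' \<in> X \<Longrightarrow> dist x' x < \<eta>2 \<Longrightarrow> dist (f x') (f x) < \<epsilon> / 4"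
    using uniformly_continuous_onE[of X f "\<epsilon> / 4"] e by auto
  define \<eta> where "\<eta> = min \<delta> (min \<eta>1 \<eta>2)"
  have \<eta>: "0 < \<eta>" using d \<eta>1(1) \<eta>2(1) by (simp add: \<eta>_def)
  obtain J where J: "finite J" "J \<subseteq> X" "X \<subseteq> (\<Union>y\<in>J. ball y \<eta>)"
    using seq_compact_imp_totally_bounded[OF compact_imp_seq_compact[OF X], rule_format, OF \<eta>]
    by (elim exE conjE)
  let ?bad = "\<lambda>n \<omega>. (\<exists>y\<in>J. \<epsilon> / 4 \<le> \<bar>s n y \<omega> - f y\<bar>) \<or> K \<le> A n \<omega>"
  have "exponentially_small M ?bad"
    by (rule exponentially_small_disj[OF exponentially_small_finite_Bex[OF J(1)] tail],
        rule pointwise) (use J(2) e in auto)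
  then show ?thesis
  proof (rule exponentially_small_mono_AE[OF _ event])
    fix n :: nat assume "n \<ge> 1"
    from modulus[OF this]
    show "AE \<omega> in M. ereal \<epsilon> \<le> (SUP x\<in>X. ereal \<bar>s n x \<omega> - f x\<bar>) \<longrightarrow> ?bad n \<omega>"
    proof eventually_elim
      case (elim \<omega>)
      show ?case
      proof (rule impI, rule ccontr)
        assume sup: "ereal \<epsilon> \<le> (SUP x\<in>X. ereal \<bar>s n x \<omega> - f x\<bar>)" and not_bad: "\<not> ?bad n \<omega>"
        from not_bad have good: "\<And>y. y \<in> J \<Longrightarrow> \<bar>s n y \<omega> - f y\<bar> < \<epsilon> / 4" "A n \<omega> < K"
          by (auto simp: not_le)
        have "\<bar>s n x \<omega> - f x\<bar> \<le> 3 * \<epsilon> / 4" if x: "x \<in> X" for x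
        proof -
          obtain y where y: "y \<in> J" "dist y x < \<eta>" using J(3) x by auto
          have fy: "\<bar>f y - f x\<bar> < \<epsilon> / 4"
            using \<eta>2(2)[OF x, of y] y J(2) by (auto simp: \<eta>_def dist_real_def)
          have "\<bar>s n x \<omega> - s n y \<omega>\<bar> \<le> \<epsilon> / 4"
          proof (cases "x = y")
            case False
            let ?d = "norm (x - y)"
            have d': "0 < ?d" "?d < \<delta>" "?d < \<eta>1"
              using False y(2) by (auto simp: \<eta>_def dist_norm norm_minus_commute)
            have "\<bar>s n x \<omega> - s n y \<omega>\<bar> \<le> A n \<omega> * w ?d"
              using elim x y(1) J(2) d' by blast
            also have "\<dots> \<le> K * c"
              using good(2) \<eta>1(2)[OF d'(1,3)] K by (intro mult_mono) auto
            finally show ?thesis by (simp add: c(2))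
          qed (use e in simp)
          with fy good(1)[OF y(1)] show ?thesis by linarith
        qed
        then have "(SUP x\<in>X. ereal \<bar>s n x \<omega> - f x\<bar>) \<le> ereal (3 * \<epsilon> / 4)"
          by (intro SUP_least) simp
        then have "ereal \<epsilon> \<le> ereal (3 * \<epsilon> / 4)" using sup by (rule order_trans[rotated])
        then show False using e by simp
      qed
    qed
  qed
qed

section \<open>The natural filtration\<close>

lemma sets_natural_filtration:
  "sets (natural_filtration M \<theta> i) =
     sigma_sets (space M) (\<Union>k\<in>{1..i}. {\<theta> k -` B \<inter> space M | B. B \<in> sets borel})"
  unfolding natural_filtration_def by (rule sets_measure_of) auto

lemma space_natural_filtration: "space (natural_filtration M \<theta> i) = space M"
  unfolding natural_filtration_def by (rule space_measure_of) auto

lemma subalgebra_natural_filtration: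
  assumes "\<And>i. 1 \<le> i \<Longrightarrow> \<theta> i \<in> borel_measurable M"
  shows "subalgebra M (natural_filtration M \<theta> i)"
  unfolding subalgebra_def space_natural_filtration sets_natural_filtration
  using assms by (auto intro!: sets.sigma_sets_subset measurable_sets)

lemma sets_natural_filtration_mono:
  "i \<le> j \<Longrightarrow> sets (natural_filtration M \<theta> i) \<subseteq> sets (natural_filtration M \<theta> j)"
  unfolding sets_natural_filtration by (rule sigma_sets_mono') fastforce

lemma measurable_natural_filtration:
  "1 \<le> i \<Longrightarrow> \<theta> i \<in> borel_measurable (natural_filtration M \<theta> i)"
  by (rule measurableI) (force simp: space_natural_filtration sets_natural_filtration)+

text \<open>The densities and coefficients of step \<open>i\<close> depend on the first \<open>i - 1\<close> samples, so
  evaluating them at the \<open>i\<close>-th sample uses exactly the first \<open>i\<close> samples.\<close>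

lemma borel_measurable_evaluate_at_sample:
  fixes \<theta> :: "nat \<Rightarrow> 'w \<Rightarrow> 'a::euclidean_space"
  assumes i: "1 \<le> i"
    and h: "(\<lambda>(\<omega>, t). h \<omega> t) \<in> borel_measurable (natural_filtration M \<theta> (i - 1) \<Otimes>\<^sub>M borel)"
  shows "(\<lambda>\<omega>. h \<omega> (\<theta> i \<omega>)) \<in> borel_measurable (natural_filtration M \<theta> i)"
proof -
  let ?G = "natural_filtration M \<theta>"
  have "(\<lambda>\<omega>. \<omega>) \<in> measurable (?G i) (?G (i - 1))"
    using sets_natural_filtration_mono[of "i - 1" i M \<theta>] sets.sets_into_space[of _ "?G (i - 1)"]
    by (intro measurableI) (auto simp: space_natural_filtration Int_absorb2)
  then have "(\<lambda>\<omega>. (\<omega>, \<theta> i \<omega>)) \<in> measurable (?G i) (?G (i - 1) \<Otimes>\<^sub>M borel)"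
    using measurable_natural_filtration[OF i, of \<theta> M] by simp
  from measurable_compose[OF this h] show ?thesis by simp
qed

section \<open>The deviation at a single point\<close>

text \<open>The bound extends from the support to all \<open>t\<close>, since off the support the quotient is a division by
  0 and equals 0.\<close>

lemma bounded_ratioE:
  assumes "bounded_ratio M \<psi> g"
  obtains C where "0 \<le> C" "AE \<omega> in M. \<forall>i\<ge>1. \<forall>t. \<bar>g t / \<psi> i \<omega> t\<bar> \<le> C"
proof -
  obtain C where C: "AE \<omega> in M.
      (SUP i\<in>{1..}. SUP t\<in>sample_support \<psi> i \<omega>. ereal \<bar>g t / \<psi> i \<omega> t\<bar>) \<le> ereal C"
    using assms by (auto simp: bounded_ratio_def)
  have "AE \<omega> in M. \<forall>i\<ge>1. \<forall>t. \<bar>g t / \<psi> i \<omega> t\<bar> \<le> max 0 C"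
    using C
  proof eventually_elim
    case (elim \<omega>)
    show ?case
    proof (intro allI impI)
      fix i :: nat and t assume i: "1 \<le> i"
      show "\<bar>g t / \<psi> i \<omega> t\<bar> \<le> max 0 C"
      proof (cases "\<psi> i \<omega> t = 0")
        case False
        then have "ereal \<bar>g t / \<psi> i \<omega> t\<bar> \<le> (SUP i\<in>{1..}. SUP t\<in>sample_support \<psi> i \<omega>. ereal \<bar>g t / \<psi> i \<omega> t\<bar>)"
          using i by (intro SUP_upper2[of i] SUP_upper2[of t]) (auto simp: sample_support_def in_support_on)
        then have "ereal \<bar>g t / \<psi> i \<omega> t\<bar> \<le> ereal C" using elim by (rule order_trans)
        then show ?thesis by simp
      qed simp
    qed
  qed
  then show thesis by (intro that[of "max 0 C"]) auto
qed

text \<open>The centred quotients are martingale differences for the natural filtration, bounded by a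
  constant. The \<open>\<epsilon>\<close> in the bound \<open>D\<close> only serves to ensure \<open>\<epsilon> \<le> 2 * D\<close>.\<close>

lemma (in prob_space) H_dev_upper_tail:
  fixes \<theta> :: "nat \<Rightarrow> 'a \<Rightarrow> 'b::euclidean_space"
  assumes \<theta>: "\<And>i. 1 \<le> i \<Longrightarrow> \<theta> i \<in> borel_measurable M"
    and cd: "\<And>i. 1 \<le> i \<Longrightarrow> conditional_density M (natural_filtration M \<theta> (i - 1)) (\<theta> i) (\<psi> i)"
    and supp: "\<And>i. 1 \<le> i \<Longrightarrow> AE \<omega> in M. \<Theta> \<subseteq> sample_support \<psi> i \<omega>"
    and int: "set_integrable lborel \<Theta> (F x)"
    and F0: "\<And>t. t \<notin> \<Theta> \<Longrightarrow> F x t = 0"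
    and bd: "bounded_ratio M \<psi> (F x)"
    and e: "0 < \<epsilon>"
  shows "exponentially_small M (\<lambda>n \<omega>. \<epsilon> \<le> H_dev \<Theta> \<theta> \<psi> F n x \<omega>)"
proof -
  let ?G = "natural_filtration M \<theta>"
  define I where "I = integral_fun \<Theta> F x"
  define R where "R i \<omega> t = F x t / \<psi> i \<omega> t" for i \<omega> t
  define Y where "Y i \<omega> = R i \<omega> (\<theta> i \<omega>) - I" for i \<omega>
  have sub: "subalgebra M (?G i)" for i by (rule subalgebra_natural_filtration[OF \<theta>])
  have ind: "(\<lambda>t. indicator \<Theta> t *\<^sub>R F x t) = F x" using F0 by (auto simp: indicator_def fun_eq_iff)
  have Fm[measurable]: "F x \<in> borel_measurable borel"
    using int unfolding set_integrable_def ind by (auto dest: borel_measurable_integrable)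
  have I: "I = (LINT t|lborel. F x t)"
    unfolding I_def integral_fun_def set_lebesgue_integral_def ind ..
  have Rm: "(\<lambda>(\<omega>, t). R i \<omega> t) \<in> borel_measurable (?G (i - 1) \<Otimes>\<^sub>M borel)" if "1 \<le> i" for i
  proof -
    have "(\<lambda>(\<omega>, t). \<psi> i \<omega> t) \<in> borel_measurable (?G (i - 1) \<Otimes>\<^sub>M borel)"
      using cd[OF that] by (simp add: conditional_density_def)
    then show ?thesis unfolding R_def case_prod_unfold by measurable
  qed
  obtain C where C: "0 \<le> C" "AE \<omega> in M. \<forall>i\<ge>1. \<forall>t. \<bar>R i \<omega> t\<bar> \<le> C"
    using bounded_ratioE[OF bd] unfolding R_def by blast
  have RG: "(\<lambda>\<omega>. R i \<omega> (\<theta> i \<omega>)) \<in> borel_measurable (?G i)" if "1 \<le> i" for i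
    using borel_measurable_evaluate_at_sample[OF that Rm[OF that]] .
  have Ri: "integrable M (\<lambda>\<omega>. R i \<omega> (\<theta> i \<omega>))" if "1 \<le> i" for i
  proof (rule integrable_const_bound[of _ C])
    show "AE \<omega> in M. norm (R i \<omega> (\<theta> i \<omega>)) \<le> C" using C(2) by eventually_elim (use that in auto)
    show "(\<lambda>\<omega>. R i \<omega> (\<theta> i \<omega>)) \<in> borel_measurable M" by (rule measurable_from_subalg[OF sub RG[OF that]])
  qed
  define D where "D = C + \<bar>I\<bar> + \<epsilon>"
  have D: "0 < D" "\<epsilon> \<le> 2 * D" using C(1) e by (auto simp: D_def)
  have bound: "prob {\<omega> \<in> space M. real n * \<epsilon> \<le> (\<Sum>i=1..n. Y i \<omega>)} \<le> exp (- (real n * (\<epsilon> / (2 * D))\<^sup>2))" for n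
  proof (rule azuma_hoeffding[where G = ?G])
    show "Y i \<in> borel_measurable (?G i)" if "1 \<le> i" for i
      unfolding Y_def using RG[OF that] by simp
    show "AE \<omega> in M. \<bar>Y i \<omega>\<bar> \<le> D" if "1 \<le> i" for i
      using C(2)
    proof eventually_elim
      case (elim \<omega>)
      then have "\<bar>R i \<omega> (\<theta> i \<omega>)\<bar> \<le> C" using that by blast
      then show ?case using e unfolding Y_def D_def by linarith
    qed
    show "AE \<omega> in M. real_cond_exp M (?G (i - 1)) (Y i) \<omega> = 0" if i: "1 \<le> i" for i
    proof -
      interpret finite_measure_subalgebra M "?G (i - 1)" by unfold_locales (rule sub)
      have "AE \<omega> in M. real_cond_exp M (?G (i - 1)) (Y i) \<omega> =
          real_cond_exp M (?G (i - 1)) (\<lambda>\<omega>. R i \<omega> (\<theta> i \<omega>)) \<omega> - real_cond_exp M (?G (i - 1)) (\<lambda>_. I) \<omega>"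
        unfolding Y_def by (rule real_cond_exp_diff[OF Ri[OF i]]) simp
      moreover have "AE \<omega> in M. real_cond_exp M (?G (i - 1)) (\<lambda>_. I) \<omega> = I"
        by (rule real_cond_exp_F_meas) simp_all
      moreover have "AE \<omega> in M. real_cond_exp M (?G (i - 1)) (\<lambda>\<omega>. R i \<omega> (\<theta> i \<omega>)) \<omega>
          = (LINT t|lborel. \<psi> i \<omega> t * R i \<omega> t)"
        by (rule conditional_expectation_of_sample[OF sub \<theta>[OF i] cd[OF i] Rm[OF i] Ri[OF i]])
      ultimately show ?thesis
        using supp[OF i]
      proof eventually_elim
        case (elim \<omega>)
        \<comment> \<open>Where \<open>\<psi> i \<omega>\<close> vanishes, \<open>t\<close> lies outside \<open>\<Theta>\<close> and both sides are 0.\<close>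
        have "\<psi> i \<omega> t * R i \<omega> t = F x t" for t
          using F0[of t] elim(4) by (cases "t \<in> \<Theta>") (auto simp: R_def sample_support_def in_support_on)
        then show ?case using elim(1-3) I by simp
      qed
    qed
    show "sets (?G i) \<subseteq> sets (?G j)" if "i \<le> j" for i j
      using that by (rule sets_natural_filtration_mono)
  qed (use sub D e in auto)
  have eq: "\<epsilon> \<le> H_dev \<Theta> \<theta> \<psi> F n x \<omega> \<longleftrightarrow> real n * \<epsilon> \<le> (\<Sum>i=1..n. Y i \<omega>)" if "1 \<le> n" for n \<omega>
  proof -
    have "(\<Sum>i=1..n. Y i \<omega>) = real n * H_dev \<Theta> \<theta> \<psi> F n x \<omega>"
      using that by (simp add: Y_def R_def H_dev_def sample_average_def I_def sum_subtractf right_diff_distrib)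
    then show ?thesis using that by simp
  qed
  show ?thesis
  proof (rule exponentially_smallI[of 1 "(\<epsilon> / (2 * D))\<^sup>2"])
    have "Y i \<in> borel_measurable M" if "1 \<le> i" for i
      unfolding Y_def using Ri[OF that] by simp
    then have "(\<lambda>\<omega>. \<Sum>i=1..n. Y i \<omega>) \<in> borel_measurable M" for n
      by (intro borel_measurable_sum) simp
    then show "{\<omega> \<in> space M. \<epsilon> \<le> H_dev \<Theta> \<theta> \<psi> F n x \<omega>} \<in> sets M" if "1 \<le> n" for n
      unfolding eq[OF that] by measurable
    show "prob {\<omega> \<in> space M. \<epsilon> \<le> H_dev \<Theta> \<theta> \<psi> F n x \<omega>} \<le> 1 * exp (- (real n * (\<epsilon> / (2 * D))\<^sup>2))"
      if "1 \<le> n" for n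
      unfolding eq[OF that] using bound by simp
  qed (use e D in auto)
qed

text \<open>The lower tail for \<open>F\<close> is the upper tail for \<open>- F\<close>.\<close>

lemma (in prob_space) H_dev_exponentially_small:
  fixes \<theta> :: "nat \<Rightarrow> 'a \<Rightarrow> 'b::euclidean_space"
  assumes \<theta>: "\<And>i. 1 \<le> i \<Longrightarrow> \<theta> i \<in> borel_measurable M"
    and cd: "\<And>i. 1 \<le> i \<Longrightarrow> conditional_density M (natural_filtration M \<theta> (i - 1)) (\<theta> i) (\<psi> i)"
    and supp: "\<And>i. 1 \<le> i \<Longrightarrow> AE \<omega> in M. \<Theta> \<subseteq> sample_support \<psi> i \<omega>"
    and int: "set_integrable lborel \<Theta> (F x)"
    and F0: "\<And>t. t \<notin> \<Theta> \<Longrightarrow> F x t = 0"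
    and bd: "bounded_ratio M \<psi> (F x)"
    and e: "0 < \<epsilon>"
  shows "exponentially_small M (\<lambda>n \<omega>. \<epsilon> \<le> \<bar>H_dev \<Theta> \<theta> \<psi> F n x \<omega>\<bar>)"
proof -
  have "set_integrable lborel \<Theta> (\<lambda>t. - F x t)"
    using int unfolding set_integrable_def by simp
  moreover have "bounded_ratio M \<psi> (\<lambda>t. - F x t)"
    using bd unfolding bounded_ratio_def by simp
  ultimately have "exponentially_small M (\<lambda>n \<omega>. \<epsilon> \<le> H_dev \<Theta> \<theta> \<psi> (\<lambda>x t. - F x t) n x \<omega>)"
    using F0 by (intro H_dev_upper_tail \<theta> cd supp e) auto
  moreover have "H_dev \<Theta> \<theta> \<psi> (\<lambda>x t. - F x t) n x \<omega> = - H_dev \<Theta> \<theta> \<psi> F n x \<omega>" for n \<omega>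
    by (simp add: H_dev_def sample_average_def integral_fun_def set_lebesgue_integral_def sum_negf)
  ultimately have "exponentially_small M (\<lambda>n \<omega>. \<epsilon> \<le> H_dev \<Theta> \<theta> \<psi> F n x \<omega> \<or> \<epsilon> \<le> - H_dev \<Theta> \<theta> \<psi> F n x \<omega>)"
    by (intro exponentially_small_disj H_dev_upper_tail[where F = F] assms) auto
  moreover have "\<epsilon> \<le> \<bar>r\<bar> \<longleftrightarrow> \<epsilon> \<le> r \<or> \<epsilon> \<le> - r" for r :: real by arith
  ultimately show ?thesis by simp
qed

section \<open>Calmness of the integrand\<close>

text \<open>The lower estimate also holds for the exchanged pair \<open>x', x\<close>, and the modulus sees only the
  symmetric quantity \<open>norm (x - x')\<close>.\<close>

lemma AMMC_below_two_sided:
  assumes "strictly_AMMC_below_at M \<psi> X F w \<alpha> x0"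
  shows "\<exists>\<delta>>0. \<forall>i\<ge>1. AE \<omega> in M. \<forall>t\<in>sample_support \<psi> i \<omega>. \<forall>x\<in>X. \<forall>x'\<in>X.
        0 < norm (x - x') \<and> norm (x - x') < \<delta> \<longrightarrow>
        \<bar>F x t - F x' t\<bar> \<le> \<alpha> i \<omega> t * w (norm (x - x'))"
proof -
  obtain \<delta> where \<delta>: "\<delta> > 0" and low: "\<And>i. i \<ge> 1 \<Longrightarrow> AE \<omega> in M. \<forall>t\<in>sample_support \<psi> i \<omega>. \<forall>x\<in>X. \<forall>x'\<in>X.
        0 < norm (x - x') \<and> norm (x - x') < \<delta> \<longrightarrow> F x t - F x' t \<ge> - \<alpha> i \<omega> t * w (norm (x - x'))"
    using assms unfolding strictly_AMMC_below_at_def by auto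
  have "AE \<omega> in M. \<forall>t\<in>sample_support \<psi> i \<omega>. \<forall>x\<in>X. \<forall>x'\<in>X.
        0 < norm (x - x') \<and> norm (x - x') < \<delta> \<longrightarrow> \<bar>F x t - F x' t\<bar> \<le> \<alpha> i \<omega> t * w (norm (x - x'))"
    if i: "i \<ge> 1" for i
    using low[OF i]
  proof (eventually_elim, intro ballI impI)
    fix \<omega> t x x'
    assume *: "\<forall>t\<in>sample_support \<psi> i \<omega>. \<forall>x\<in>X. \<forall>x'\<in>X.
        0 < norm (x - x') \<and> norm (x - x') < \<delta> \<longrightarrow> F x t - F x' t \<ge> - \<alpha> i \<omega> t * w (norm (x - x'))"
      and t: "t \<in> sample_support \<psi> i \<omega>" and x: "x \<in> X" "x' \<in> X"
      and d: "0 < norm (x - x') \<and> norm (x - x') < \<delta>"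
    have "F x t - F x' t \<ge> - \<alpha> i \<omega> t * w (norm (x - x'))" using * t x d by blast
    moreover have "F x' t - F x t \<ge> - \<alpha> i \<omega> t * w (norm (x' - x))"
      using * t x d by (metis norm_minus_commute)
    ultimately show "\<bar>F x t - F x' t\<bar> \<le> \<alpha> i \<omega> t * w (norm (x - x'))"
      by (simp add: norm_minus_commute)
  qed
  then show ?thesis using \<delta> by blast
qed

lemma AMMC_above_two_sided:
  assumes "strictly_AMMC_above_at M \<psi> X F w \<alpha> x0"
  shows "\<exists>\<delta>>0. \<forall>i\<ge>1. AE \<omega> in M. \<forall>t\<in>sample_support \<psi> i \<omega>. \<forall>x\<in>X. \<forall>x'\<in>X.
        0 < norm (x - x') \<and> norm (x - x') < \<delta> \<longrightarrow>
        \<bar>F x t - F x' t\<bar> \<le> \<alpha> i \<omega> t * w (norm (x - x'))"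
proof -
  have "\<bar>- F x t - - F x' t\<bar> = \<bar>F x t - F x' t\<bar>" for x x' t by simp
  then show ?thesis
    using AMMC_below_two_sided[OF assms[unfolded strictly_AMMC_above_at_def]] by simp
qed

text \<open>Almost surely every sample lies in its own support, where the estimate for \<open>F\<close> holds and the density
  is positive. Hence the estimate can be divided by the density and averaged.\<close>

lemma (in prob_space) sample_average_modulus:
  fixes \<theta> :: "nat \<Rightarrow> 'a \<Rightarrow> 'b::euclidean_space"
  assumes \<theta>: "\<And>i. 1 \<le> i \<Longrightarrow> \<theta> i \<in> borel_measurable M"
    and cd: "\<And>i. 1 \<le> i \<Longrightarrow> conditional_density M (natural_filtration M \<theta> (i - 1)) (\<theta> i) (\<psi> i)"
    and F: "\<And>i. 1 \<le> i \<Longrightarrow> AE \<omega> in M. \<forall>t\<in>sample_support \<psi> i \<omega>. \<forall>x\<in>X. \<forall>x'\<in>X.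
        0 < norm (x - x') \<and> norm (x - x') < \<delta> \<longrightarrow> \<bar>F x t - F x' t\<bar> \<le> \<alpha> i \<omega> t * w (norm (x - x'))"
  shows "AE \<omega> in M. \<forall>x\<in>X. \<forall>x'\<in>X. 0 < norm (x - x') \<and> norm (x - x') < \<delta> \<longrightarrow>
        \<bar>sample_average \<theta> \<psi> F n x \<omega> - sample_average \<theta> \<psi> F n x' \<omega>\<bar>
          \<le> A_avg \<theta> \<psi> \<alpha> n \<omega> * w (norm (x - x'))"
proof -
  have "AE \<omega> in M. \<forall>i\<in>{1..n}. \<psi> i \<omega> (\<theta> i \<omega>) \<noteq> 0"
    by (intro AE_ball_countable[THEN iffD2] ballI
        density_at_sample_nonzero[OF subalgebra_natural_filtration[OF \<theta>] \<theta> cd]) auto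
  moreover have "AE \<omega> in M. \<forall>i\<in>{1..n}. \<forall>t\<in>sample_support \<psi> i \<omega>. \<forall>x\<in>X. \<forall>x'\<in>X.
        0 < norm (x - x') \<and> norm (x - x') < \<delta> \<longrightarrow> \<bar>F x t - F x' t\<bar> \<le> \<alpha> i \<omega> t * w (norm (x - x'))"
    by (intro AE_ball_countable[THEN iffD2] ballI F) auto
  ultimately show ?thesis
    using AE_space
  proof (eventually_elim, intro ballI impI)
    fix \<omega> x x'
    assume nz: "\<forall>i\<in>{1..n}. \<psi> i \<omega> (\<theta> i \<omega>) \<noteq> 0"
      and Fw: "\<forall>i\<in>{1..n}. \<forall>t\<in>sample_support \<psi> i \<omega>. \<forall>x\<in>X. \<forall>x'\<in>X.
        0 < norm (x - x') \<and> norm (x - x') < \<delta> \<longrightarrow> \<bar>F x t - F x' t\<bar> \<le> \<alpha> i \<omega> t * w (norm (x - x'))"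
      and \<omega>: "\<omega> \<in> space M" and x: "x \<in> X" "x' \<in> X"
      and d: "0 < norm (x - x') \<and> norm (x - x') < \<delta>"
    let ?w = "w (norm (x - x'))"
    let ?a = "\<lambda>i. \<alpha> i \<omega> (\<theta> i \<omega>) / \<psi> i \<omega> (\<theta> i \<omega>)"
    let ?r = "\<lambda>x i. F x (\<theta> i \<omega>) / \<psi> i \<omega> (\<theta> i \<omega>)"
    have "\<bar>?r x i - ?r x' i\<bar> \<le> ?a i * ?w" if i: "i \<in> {1..n}" for i
    proof -
      have s: "\<theta> i \<omega> \<in> sample_support \<psi> i \<omega>" using nz i by (simp add: sample_support_def in_support_on)
      have pos: "0 \<le> \<psi> i \<omega> (\<theta> i \<omega>)" using cd[of i] i \<omega> by (auto simp: conditional_density_def)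
      have "\<bar>F x (\<theta> i \<omega>) - F x' (\<theta> i \<omega>)\<bar> \<le> \<alpha> i \<omega> (\<theta> i \<omega>) * ?w" using Fw i s x d by blast
      then have "\<bar>F x (\<theta> i \<omega>) - F x' (\<theta> i \<omega>)\<bar> / \<psi> i \<omega> (\<theta> i \<omega>) \<le> \<alpha> i \<omega> (\<theta> i \<omega>) * ?w / \<psi> i \<omega> (\<theta> i \<omega>)"
        using pos by (rule divide_right_mono)
      then show ?thesis using pos by (simp add: diff_divide_distrib[symmetric] abs_divide)
    qed
    then have "\<bar>\<Sum>i=1..n. ?r x i - ?r x' i\<bar> \<le> (\<Sum>i=1..n. ?a i * ?w)"
      by (intro order_trans[OF sum_abs] sum_mono) auto
    then have "\<bar>\<Sum>i=1..n. ?r x i - ?r x' i\<bar> / real n \<le> (\<Sum>i=1..n. ?a i * ?w) / real n"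
      by (rule divide_right_mono) simp
    then show "\<bar>sample_average \<theta> \<psi> F n x \<omega> - sample_average \<theta> \<psi> F n x' \<omega>\<bar> \<le> A_avg \<theta> \<psi> \<alpha> n \<omega> * ?w"
      unfolding sample_average_def A_avg_def sum_subtractf sum_distrib_right[symmetric]
      by (simp add: diff_divide_distrib[symmetric] abs_divide)
  qed
qed

text \<open>One instance of the tail condition suffices, here \<open>\<epsilon> = 1\<close>: the constant \<open>K\<close> is absorbed
  by choosing a fine enough net of \<open>X\<close>.\<close>

lemma coefficient_tail_exponentially_small:
  fixes \<theta> :: "nat \<Rightarrow> 'w \<Rightarrow> 'a::euclidean_space"
  assumes \<theta>: "\<And>i. 1 \<le> i \<Longrightarrow> \<theta> i \<in> borel_measurable M"
    and cd: "\<And>i. 1 \<le> i \<Longrightarrow> conditional_density M (natural_filtration M \<theta> (i - 1)) (\<theta> i) (\<psi> i)"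
    and \<alpha>: "adaptive_multiple_coefficient M \<theta> \<psi> \<alpha>"
    and tail: "coefficient_tail M \<theta> \<psi> \<alpha>"
  shows "\<exists>K>0. exponentially_small M (\<lambda>n \<omega>. K \<le> A_avg \<theta> \<psi> \<alpha> n \<omega>)"
proof -
  obtain K \<tau> where K: "0 < K" "0 < \<tau>"
    "\<And>n. 1 \<le> n \<Longrightarrow> measure M {\<omega> \<in> space M. A_avg \<theta> \<psi> \<alpha> n \<omega> \<ge> K} \<le> exp (- (real n * \<tau>))"
    using tail unfolding coefficient_tail_def by (metis mult_1 zero_less_one)
  have [measurable]: "A_avg \<theta> \<psi> \<alpha> n \<in> borel_measurable M" for n
  proof -
    have "(\<lambda>\<omega>. \<alpha> i \<omega> (\<theta> i \<omega>) / \<psi> i \<omega> (\<theta> i \<omega>)) \<in> borel_measurable M" if i: "i \<in> {1..n}" for i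
    proof -
      have "(\<lambda>\<omega>. \<alpha> i \<omega> (\<theta> i \<omega>)) \<in> borel_measurable (natural_filtration M \<theta> i)"
        "(\<lambda>\<omega>. \<psi> i \<omega> (\<theta> i \<omega>)) \<in> borel_measurable (natural_filtration M \<theta> i)"
        using \<alpha> cd[of i] i
        by (auto intro!: borel_measurable_evaluate_at_sample
            simp: adaptive_multiple_coefficient_def conditional_density_def)
      then show ?thesis
        by (intro borel_measurable_divide measurable_from_subalg[OF subalgebra_natural_filtration[OF \<theta>]])
    qed
    then show ?thesis unfolding A_avg_def by (intro borel_measurable_times borel_measurable_sum) auto
  qed
  have "exponentially_small M (\<lambda>n \<omega>. K \<le> A_avg \<theta> \<psi> \<alpha> n \<omega>)"
    using K by (intro exponentially_smallI[of 1 \<tau>]) auto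
  with K(1) show ?thesis by blast
qed

section \<open>Exponential convergence\<close>

theorem theorem3p10:
  fixes M :: "'w measure"
    and X :: "(real ^ 'm) set"
    and \<Theta> :: "(real ^ 'r) set"
    and \<theta> :: "nat \<Rightarrow> 'w \<Rightarrow> real ^ 'r"
    and \<psi> :: "nat \<Rightarrow> 'w \<Rightarrow> real ^ 'r \<Rightarrow> real"
    and F :: "real ^ 'm \<Rightarrow> real ^ 'r \<Rightarrow> real"
    and w :: "real \<Rightarrow> real"
    and \<alpha> :: "nat \<Rightarrow> 'w \<Rightarrow> real ^ 'r \<Rightarrow> real"
  assumes "prob_space M"
    and "compact X"
    and "\<And>i. i \<ge> 1 \<Longrightarrow> \<theta> i \<in> borel_measurable M"
    and "\<And>i. i \<ge> 1 \<Longrightarrow>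
           conditional_density M (natural_filtration M \<theta> (i - 1)) (\<theta> i) (\<psi> i)"
    and "support_on (X \<times> UNIV) (\<lambda>(x, t). F x t) \<subseteq> X \<times> \<Theta>"
    and "\<And>i. i \<ge> 1 \<Longrightarrow> AE \<omega> in M. \<Theta> \<subseteq> sample_support \<psi> i \<omega>"
    and "\<And>x. x \<in> X \<Longrightarrow> set_integrable lborel \<Theta> (F x)"
    and "\<And>x. x \<in> X \<Longrightarrow> bounded_ratio M \<psi> (F x)"
    and "\<And>i x. i \<ge> 1 \<Longrightarrow> x \<in> X \<Longrightarrow>
           AE \<omega> in M. set_integrable lborel (sample_support \<psi> i \<omega>) (\<lambda>t. (F x t)\<^sup>2 / \<psi> i \<omega> t)"
    and "continuous_on X (integral_fun \<Theta> F)"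
    and "modulus_of_continuity w"
    and "adaptive_multiple_coefficient M \<theta> \<psi> \<alpha>"
  shows "((\<forall>x0\<in>X. strictly_AMMC_below_at M \<psi> X F w \<alpha> x0) \<and> coefficient_tail M \<theta> \<psi> \<alpha> \<longrightarrow>
           (\<forall>\<epsilon>>0. exponentially_small M
              (\<lambda>n \<omega>. (INF x\<in>X. ereal (H_dev \<Theta> \<theta> \<psi> F n x \<omega>)) \<le> ereal (- \<epsilon>)))) \<and>
         ((\<forall>x0\<in>X. strictly_AMMC_above_at M \<psi> X F w \<alpha> x0) \<and> coefficient_tail M \<theta> \<psi> \<alpha> \<longrightarrow>
           (\<forall>\<epsilon>>0. exponentially_small M
              (\<lambda>n \<omega>. (SUP x\<in>X. ereal (H_dev \<Theta> \<theta> \<psi> F n x \<omega>)) \<ge> ereal \<epsilon>))) \<and>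
         ((\<forall>x0\<in>X. strictly_AMMC_at M \<psi> X F w \<alpha> x0) \<and> coefficient_tail M \<theta> \<psi> \<alpha> \<longrightarrow>
           (\<forall>\<epsilon>>0. exponentially_small M
              (\<lambda>n \<omega>. (SUP x\<in>X. ereal \<bar>H_dev \<Theta> \<theta> \<psi> F n x \<omega>\<bar>) \<ge> ereal \<epsilon>)))"
proof -
  interpret prob_space M by fact
  note \<theta> = assms(3) and cd = assms(4) and supp = assms(6) and int = assms(7) and bd = assms(8)
    and fc = assms(10) and w = assms(11) and \<alpha> = assms(12)
  let ?H = "H_dev \<Theta> \<theta> \<psi> F"
  have F0: "F x t = 0" if "x \<in> X" "t \<notin> \<Theta>" for x t
    using subsetD[OF assms(5), of "(x, t)"] that by (auto simp: in_support_on)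
  have Hm: "?H n x \<in> borel_measurable M" if x: "x \<in> X" for n x
  proof -
    have "(\<lambda>t. indicator \<Theta> t *\<^sub>R F x t) = F x" using F0[OF x] by (auto simp: indicator_def fun_eq_iff)
    then have Fm: "F x \<in> borel_measurable borel"
      using int[OF x] unfolding set_integrable_def by (auto dest: borel_measurable_integrable)
    have "(\<lambda>\<omega>. F x (\<theta> i \<omega>) / \<psi> i \<omega> (\<theta> i \<omega>)) \<in> borel_measurable M" if i: "i \<in> {1..n}" for i
    proof -
      have "(\<lambda>\<omega>. \<psi> i \<omega> (\<theta> i \<omega>)) \<in> borel_measurable (natural_filtration M \<theta> i)"
        using cd[of i] i by (auto intro!: borel_measurable_evaluate_at_sample simp: conditional_density_def)
      then have "(\<lambda>\<omega>. \<psi> i \<omega> (\<theta> i \<omega>)) \<in> borel_measurable M"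
        by (rule measurable_from_subalg[OF subalgebra_natural_filtration, rotated]) (rule \<theta>)
      moreover have "(\<lambda>\<omega>. F x (\<theta> i \<omega>)) \<in> borel_measurable M"
        using measurable_compose[OF \<theta> Fm, of i] i by simp
      ultimately show ?thesis by (intro borel_measurable_divide)
    qed
    then show ?thesis unfolding H_dev_def sample_average_def
      by (intro borel_measurable_diff borel_measurable_times borel_measurable_sum) auto
  qed
  \<comment> \<open>The two-sided estimate implies all three bounds; they differ only in which calmness hypothesis
    supplies the estimate.\<close>
  have main: "exponentially_small M (\<lambda>n \<omega>. ereal \<epsilon> \<le> (SUP x\<in>X. ereal \<bar>?H n x \<omega>\<bar>)) \<and>
       exponentially_small M (\<lambda>n \<omega>. ereal \<epsilon> \<le> (SUP x\<in>X. ereal (?H n x \<omega>))) \<and>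
       exponentially_small M (\<lambda>n \<omega>. (INF x\<in>X. ereal (?H n x \<omega>)) \<le> ereal (- \<epsilon>))"
    if two_sided: "\<exists>\<delta>>0. \<forall>i\<ge>1. AE \<omega> in M. \<forall>t\<in>sample_support \<psi> i \<omega>. \<forall>x\<in>X. \<forall>x'\<in>X.
        0 < norm (x - x') \<and> norm (x - x') < \<delta> \<longrightarrow> \<bar>F x t - F x' t\<bar> \<le> \<alpha> i \<omega> t * w (norm (x - x'))"
      and tail: "coefficient_tail M \<theta> \<psi> \<alpha>" and e: "0 < \<epsilon>" for \<epsilon>
  proof -
    obtain \<delta> where \<delta>: "0 < \<delta>" and Fw: "\<And>i. 1 \<le> i \<Longrightarrow> AE \<omega> in M. \<forall>t\<in>sample_support \<psi> i \<omega>. \<forall>x\<in>X. \<forall>x'\<in>X.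
        0 < norm (x - x') \<and> norm (x - x') < \<delta> \<longrightarrow> \<bar>F x t - F x' t\<bar> \<le> \<alpha> i \<omega> t * w (norm (x - x'))"
      using two_sided by auto
    have "\<exists>K>0. exponentially_small M (\<lambda>n \<omega>. K \<le> A_avg \<theta> \<psi> \<alpha> n \<omega>)"
      by (rule coefficient_tail_exponentially_small) (fact \<theta> cd \<alpha> tail)+
    then obtain K where K: "0 < K" "exponentially_small M (\<lambda>n \<omega>. K \<le> A_avg \<theta> \<psi> \<alpha> n \<omega>)"
      by blast
    have modulus: "AE \<omega> in M. \<forall>x\<in>X. \<forall>x'\<in>X. 0 < norm (x - x') \<and> norm (x - x') < \<delta> \<longrightarrow>
        \<bar>sample_average \<theta> \<psi> F n x \<omega> - sample_average \<theta> \<psi> F n x' \<omega>\<bar>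
          \<le> A_avg \<theta> \<psi> \<alpha> n \<omega> * w (norm (x - x'))" for n
      by (rule sample_average_modulus) (fact \<theta> cd Fw)+
    have Hc: "AE \<omega> in M. continuous_on X (\<lambda>x. ?H n x \<omega>)" for n
      using modulus[of n]
    proof eventually_elim
      case (elim \<omega>)
      have "continuous_on X (\<lambda>x. sample_average \<theta> \<psi> F n x \<omega>)"
        by (rule continuous_on_of_modulus[OF w \<delta>]) (use elim in blast)
      then show ?case unfolding H_dev_def using fc by (rule continuous_on_diff)
    qed
    have "exponentially_small M (\<lambda>n \<omega>. ereal \<epsilon> \<le> (SUP x\<in>X. ereal \<bar>sample_average \<theta> \<psi> F n x \<omega> - integral_fun \<Theta> F x\<bar>))"
    proof (rule uniform_deviation_exponentially_small[OF assms(2) fc w \<delta> _ K(1) K(2) modulus _ e])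
      show "exponentially_small M (\<lambda>n \<omega>. \<epsilon> \<le> \<bar>sample_average \<theta> \<psi> F n x \<omega> - integral_fun \<Theta> F x\<bar>)"
        if "x \<in> X" "0 < \<epsilon>" for x \<epsilon>
        unfolding H_dev_def[symmetric]
        by (rule H_dev_exponentially_small) (fact \<theta> cd supp int[OF that(1)] F0[OF that(1)] bd[OF that(1)] that(2))+
      have "AE \<omega> in M. continuous_on X (\<lambda>x. \<bar>?H n x \<omega>\<bar>)" for n
        using Hc[of n] by eventually_elim (rule continuous_on_rabs)
      then show "{\<omega> \<in> space M. ereal \<epsilon> \<le> (SUP x\<in>X. ereal \<bar>sample_average \<theta> \<psi> F n x \<omega> - integral_fun \<Theta> F x\<bar>)}
          \<in> sets (completion M)" for n
        unfolding H_dev_def[symmetric] using Hm by (intro SUP_event_in_completion) auto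
    qed
    then have abs: "exponentially_small M (\<lambda>n \<omega>. ereal \<epsilon> \<le> (SUP x\<in>X. ereal \<bar>?H n x \<omega>\<bar>))"
      by (simp add: H_dev_def)
    \<comment> \<open>The sign \<open>c\<close> treats the supremum of \<open>H_dev\<close> and the negated infimum together.\<close>
    have one_sided: "exponentially_small M (\<lambda>n \<omega>. ereal \<epsilon> \<le> (SUP x\<in>X. ereal (c * ?H n x \<omega>)))"
      if c: "\<bar>c\<bar> = 1" for c :: real
    proof (rule exponentially_small_mono_AE[OF abs])
      have "AE \<omega> in M. continuous_on X (\<lambda>x. c * ?H n x \<omega>)" for n
        using Hc[of n] by eventually_elim (intro continuous_intros)
      then show "{\<omega> \<in> space M. ereal \<epsilon> \<le> (SUP x\<in>X. ereal (c * ?H n x \<omega>))} \<in> sets (completion M)" for n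
        using Hm by (intro SUP_event_in_completion) auto
      have "c * r \<le> \<bar>r\<bar>" for r using c abs_ge_self[of "c * r"] by (simp add: abs_mult)
      then have "(SUP x\<in>X. ereal (c * ?H n x \<omega>)) \<le> (SUP x\<in>X. ereal \<bar>?H n x \<omega>\<bar>)" for n \<omega>
        by (intro SUP_mono) auto
      then show "AE \<omega> in M. ereal \<epsilon> \<le> (SUP x\<in>X. ereal (c * ?H n x \<omega>)) \<longrightarrow>
          ereal \<epsilon> \<le> (SUP x\<in>X. ereal \<bar>?H n x \<omega>\<bar>)" for n
        by (intro AE_I2 impI) (rule order_trans)
    qed
    have "(INF x\<in>X. ereal (?H n x \<omega>)) = - (SUP x\<in>X. ereal (- 1 * ?H n x \<omega>))" for n \<omega>
      by (subst ereal_INF_uminus_eq[symmetric]) simp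
    then have "(INF x\<in>X. ereal (?H n x \<omega>)) \<le> ereal (- \<epsilon>) \<longleftrightarrow> ereal \<epsilon> \<le> (SUP x\<in>X. ereal (- 1 * ?H n x \<omega>))" for n \<omega>
      by (simp only: uminus_ereal.simps(1)[symmetric] ereal_minus_le_minus)
    then show ?thesis using abs one_sided[of 1] one_sided[of "- 1"] by simp
  qed
  \<comment> \<open>Calmness at the points of an empty \<open>X\<close> provides no \<open>\<delta>\<close>, but then the extrema are infinite with
    the harmless sign and the events are empty.\<close>
  have empty: "exponentially_small M (\<lambda>n \<omega>. False)" by (rule exponentially_smallI[of 1 1]) auto
  show ?thesis
  proof (cases "X = {}")
    case True
    then show ?thesis using empty by (simp add: bot_ereal_def top_ereal_def)
  next
    case False
    then obtain x0 where x0: "x0 \<in> X" by auto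
    note below = main[OF AMMC_below_two_sided[of M \<psi> X F w \<alpha> x0]]
      and above = main[OF AMMC_above_two_sided[of M \<psi> X F w \<alpha> x0]]
    show ?thesis
    proof (intro conjI impI allI; elim conjE)
      fix \<epsilon> :: real
      assume e: "0 < \<epsilon>" and tail: "coefficient_tail M \<theta> \<psi> \<alpha>"
      show "exponentially_small M (\<lambda>n \<omega>. (INF x\<in>X. ereal (?H n x \<omega>)) \<le> ereal (- \<epsilon>))"
        if "\<forall>x0\<in>X. strictly_AMMC_below_at M \<psi> X F w \<alpha> x0"
        using below[OF bspec[OF that x0] tail e] by (elim conjE)
      show "exponentially_small M (\<lambda>n \<omega>. ereal \<epsilon> \<le> (SUP x\<in>X. ereal (?H n x \<omega>)))"
        if "\<forall>x0\<in>X. strictly_AMMC_above_at M \<psi> X F w \<alpha> x0"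
        using above[OF bspec[OF that x0] tail e] by (elim conjE)
      show "exponentially_small M (\<lambda>n \<omega>. ereal \<epsilon> \<le> (SUP x\<in>X. ereal \<bar>?H n x \<omega>\<bar>))"
        if "\<forall>x0\<in>X. strictly_AMMC_at M \<psi> X F w \<alpha> x0"
        using below[OF conjunct1[OF bspec[OF that x0, unfolded strictly_AMMC_at_def]] tail e]
        by (elim conjE)
    qed
  qed
qed

end
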